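(* Let $K$ be an infinite field, let $(P,L)$ be a linear space with $d=\#P$ points and $\#L\ge 2$, and let $A=R/I_\Delta$ be the associated inverse system algebra over $K$. Suppose that $A$ is level with socle degree $m\ge 3$ (equivalently, every line in $L$ has exactly $m$ points). Then: (i) $A$ has the WLP if and only if $\operatorname{char} K=0$ or $\operatorname{char} K>\left\lceil \frac{m}{2}\right\rceil$. (ii) $A$ does not have the SLP if $2\le \operatorname{char} K\le m$. (iii) $A$ has the SLP if $\operatorname{char} K=0$ or $\operatorname{char} K>\max\left\{m,\frac{d-1}{m-1}\right\}=\frac{d-1}{m-1}$. (iv) If $(P,L)$ is a finite projective plane, then $A$ has the SLP if and only if $\operatorname{char} K=0$ or $\operatorname{char} K>m$.
   Context: A point-line incidence structure $(P,L)$ consists of a finite set $P$ of points and a finite set $L$ of lines with an incidence relation; lines are identified with the sets of points incident to them. It is a linear space if any two distinct points lie on exactly one common line and every line contains at least two points. A finite projective plane is a linear space such that any two distinct lines meet in exactly one point, there exist three noncollinear points, and every line contains at least three points. Let $d=\#P$ and $R=K[x_1,\dots,x_d]$ (standard grading), with variables indexed by the points. The incidence complex $\Lambda$ of $(P,L)$ is the simplicial complex on $P$ whose facets are the sets of points on each line; $I_\Lambda\subset R$ is its Stanley-Reisner ideal, generated by the squarefree monomials corresponding to nonfaces of $\Lambda$. The inverse system algebra is $A=R/I_\Delta$, where $I_\Delta=I_\Lambda+(x_1^2,\dots,x_d^2)$. An artinian standard graded $K$-algebra $A=\bigoplus_{i=0}^e A_i$ with $A_e\neq 0$ has socle $\{a\in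 A: x a=0 \text{ for all } x\in A_1\}$; it is level of socle degree $e$ if its socle is equal to $A_e$. $A$ has the Weak Lefschetz Property (WLP) if, for a general linear form $\ell\in A_1$ (i.e. for all $\ell$ in a nonempty Zariski open subset of $A_1$), every multiplication map $\times\ell:A_i\to A_{i+1}$ has maximal rank (is injective or surjective). $A$ has the Strong Lefschetz Property (SLP) if, for a general linear form $\ell$, the maps $\times\ell^j:A_i\to A_{i+j}$ have maximal rank for all $i,j\ge 0$. *)

theory Defs
  imports
    "HOL-Library.Poly_Mapping"
    "HOL-Algebra.QuotRing"
    "HOL-Algebra.Algebraic_Closure_Type"
begin

section \<open>Point-line geometries\<close>

text \<open>The finite set of points is a finite type; lines are sets of points, so a geometry is
  given by its set of lines alone.\<close>

definition linear_space :: "'p::finite set set \<Rightarrow> bool" where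
  "linear_space L \<longleftrightarrow>
     (\<forall>a b. a \<noteq> b \<longrightarrow> (\<exists>!l. l \<in> L \<and> a \<in> l \<and> b \<in> l)) \<and> (\<forall>l\<in>L. card l \<ge> 2)"

definition finite_projective_plane :: "'p::finite set set \<Rightarrow> bool" where
  "finite_projective_plane L \<longleftrightarrow>
     linear_space L \<and>
     (\<forall>l\<in>L. \<forall>l'\<in>L. l \<noteq> l' \<longrightarrow> (\<exists>!a. a \<in> l \<and> a \<in> l')) \<and>
     (\<exists>a b c. distinct [a, b, c] \<and> \<not> (\<exists>l\<in>L. {a, b, c} \<subseteq> l)) \<and>
     (\<forall>l\<in>L. card l \<ge> 3)"

text \<open>The simplicial complex, as its set of faces, spanned by the lines.\<close>

definition incidence_complex :: "'p::finite set set \<Rightarrow> 'p set set" where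
  "incidence_complex L = {F. \<exists>l\<in>L. F \<subseteq> l}"

definition facets :: "'p set set \<Rightarrow> 'p set set" where
  "facets \<Lambda> = {F \<in> \<Lambda>. \<forall>G\<in>\<Lambda>. F \<subseteq> G \<longrightarrow> F = G}"

lemma facets_incidence_complex:
  assumes "linear_space L"
  shows "facets (incidence_complex L) = L"
proof -
  have eq: "l = l'" if l: "l \<in> L" "l' \<in> L" "l \<subseteq> l'" for l l'
  proof -
    have "card l \<ge> 2"
      using assms l(1) by (simp add: linear_space_def)
    then obtain a b where "a \<in> l" "b \<in> l" "a \<noteq> b"
      by (metis One_nat_def card_le_Suc0_iff_eq finite not_less_eq_eq numeral_2_eq_2)
    then show ?thesis
      using assms l unfolding linear_space_def by (metis subsetD)
  qed
  show ?thesis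
  proof (intro subset_antisym subsetI)
    fix F assume "F \<in> facets (incidence_complex L)"
    then show "F \<in> L"
      unfolding facets_def incidence_complex_def by auto
  next
    fix l assume l: "l \<in> L"
    have "l = G" if "G \<subseteq> l'" "l' \<in> L" "l \<subseteq> G" for G l'
      using eq[OF l \<open>l' \<in> L\<close>] that by blast
    then show "l \<in> facets (incidence_complex L)"
      using l unfolding facets_def incidence_complex_def by auto
  qed
qed

section \<open>The polynomial ring and its graded quotients\<close>

text \<open>An element of the polynomial ring over \<open>'k\<close> with one variable for each point maps a
  monomial, that is, an exponent vector \<open>'p \<Rightarrow>\<^sub>0 nat\<close>, to its coefficient.\<close>

type_synonym ('p, 'k) mpoly = "('p \<Rightarrow>\<^sub>0 nat) \<Rightarrow>\<^sub>0 'k"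

definition mvar :: "'p \<Rightarrow> ('p, 'k::field) mpoly" where
  "mvar p = Poly_Mapping.single (Poly_Mapping.single p 1) 1"

definition mconst :: "'k \<Rightarrow> ('p, 'k::field) mpoly" where
  "mconst c = Poly_Mapping.single 0 c"

definition mon_degree :: "('p::finite \<Rightarrow>\<^sub>0 nat) \<Rightarrow> nat" where
  "mon_degree t = (\<Sum>p\<in>UNIV. Poly_Mapping.lookup t p)"

text \<open>The zero polynomial is homogeneous of every degree.\<close>

definition homogeneous :: "nat \<Rightarrow> ('p::finite, 'k::field) mpoly \<Rightarrow> bool" where
  "homogeneous i f \<longleftrightarrow> (\<forall>t\<in>Poly_Mapping.keys f. mon_degree t = i)"

definition meval :: "('p::finite, 'k::field) mpoly \<Rightarrow> ('p \<Rightarrow> 'k) \<Rightarrow> 'k" where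
  "meval f a = (\<Sum>t\<in>Poly_Mapping.keys f.
     Poly_Mapping.lookup f t * (\<Prod>p\<in>UNIV. a p ^ Poly_Mapping.lookup t p))"

definition linear_form :: "('p::finite \<Rightarrow> 'k::field) \<Rightarrow> ('p, 'k) mpoly" where
  "linear_form a = (\<Sum>p\<in>UNIV. mconst (a p) * mvar p)"

abbreviation poly_ring :: "('p::finite, 'k::field) mpoly ring" where
  "poly_ring \<equiv> ring_of_type_algebra"

text \<open>In what follows a homogeneous ideal \<open>I\<close> stands for the standard graded algebra \<open>R/I\<close>, whose
  \<open>i\<close>-th graded piece consists of the classes of the homogeneous polynomials of degree \<open>i\<close>.\<close>

definition quot_alg :: "('p::finite, 'k::field) mpoly set \<Rightarrow> ('p, 'k) mpoly set ring" where
  "quot_alg I = poly_ring Quot I"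

definition graded_piece ::
    "('p::finite, 'k::field) mpoly set \<Rightarrow> nat \<Rightarrow> ('p, 'k) mpoly set set" where
  "graded_piece I i = {I +>\<^bsub>poly_ring\<^esub> f | f. homogeneous i f}"

definition socle :: "('p::finite, 'k::field) mpoly set \<Rightarrow> ('p, 'k) mpoly set set" where
  "socle I = {a \<in> carrier (quot_alg I).
     \<forall>x\<in>graded_piece I 1. x \<otimes>\<^bsub>quot_alg I\<^esub> a = \<zero>\<^bsub>quot_alg I\<^esub>}"

definition level_of_socle_degree :: "('p::finite, 'k::field) mpoly set \<Rightarrow> nat \<Rightarrow> bool" where
  "level_of_socle_degree I e \<longleftrightarrow>
     graded_piece I e \<noteq> {\<zero>\<^bsub>quot_alg I\<^esub>} \<and>
     (\<forall>i>e. graded_piece I i = {\<zero>\<^bsub>quot_alg I\<^esub>}) \<and>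
     socle I = graded_piece I e"

section \<open>Lefschetz properties\<close>

definition zariski_open :: "('p::finite \<Rightarrow> 'k::field) set \<Rightarrow> bool" where
  "zariski_open U \<longleftrightarrow> (\<exists>F :: ('p, 'k) mpoly set. U = {a. \<exists>f\<in>F. meval f a \<noteq> 0})"

text \<open>The degree one piece is a quotient vector space of the space of coefficient vectors of linear
  forms. A set of linear forms is therefore Zariski open if and only if its preimage is.\<close>

definition zariski_open_forms ::
    "('p::finite, 'k::field) mpoly set \<Rightarrow> ('p, 'k) mpoly set set \<Rightarrow> bool" where
  "zariski_open_forms I U \<longleftrightarrow>
     U \<subseteq> graded_piece I 1 \<and> zariski_open {a. I +>\<^bsub>poly_ring\<^esub> linear_form a \<in> U}"

definition holds_for_general_form ::
    "('p::finite, 'k::field) mpoly set \<Rightarrow> (('p, 'k) mpoly set \<Rightarrow> bool) \<Rightarrow> bool" where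
  "holds_for_general_form I Q \<longleftrightarrow>
     (\<exists>U. zariski_open_forms I U \<and> U \<noteq> {} \<and> (\<forall>l\<in>U. Q l))"

definition maximal_rank :: "('a \<Rightarrow> 'b) \<Rightarrow> 'a set \<Rightarrow> 'b set \<Rightarrow> bool" where
  "maximal_rank \<phi> V W \<longleftrightarrow> inj_on \<phi> V \<or> \<phi> ` V = W"

definition WLP :: "('p::finite, 'k::field) mpoly set \<Rightarrow> bool" where
  "WLP I \<longleftrightarrow> holds_for_general_form I (\<lambda>l. \<forall>i.
     maximal_rank (\<lambda>a. l \<otimes>\<^bsub>quot_alg I\<^esub> a) (graded_piece I i) (graded_piece I (i + 1)))"

definition SLP :: "('p::finite, 'k::field) mpoly set \<Rightarrow> bool" where
  "SLP I \<longleftrightarrow> holds_for_general_form I (\<lambda>l. \<forall>i j :: nat.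
     maximal_rank (\<lambda>a. (l [^]\<^bsub>quot_alg I\<^esub> j) \<otimes>\<^bsub>quot_alg I\<^esub> a)
       (graded_piece I i) (graded_piece I (i + j)))"

section \<open>The inverse system algebra of a geometry\<close>

definition stanley_reisner_ideal ::
    "'p::finite set set \<Rightarrow> ('p, 'k::field) mpoly set" where
  "stanley_reisner_ideal \<Lambda> = Idl\<^bsub>poly_ring\<^esub> {\<Prod>p\<in>F. mvar p | F. F \<notin> \<Lambda>}"

text \<open>The ideal \<open>I\<^sub>\<Delta>\<close>; the inverse system algebra of the geometry is \<open>quot_alg (inv_sys_ideal L)\<close>.\<close>

definition inv_sys_ideal :: "'p::finite set set \<Rightarrow> ('p, 'k::field) mpoly set" where
  "inv_sys_ideal L =
     stanley_reisner_ideal (incidence_complex L) <+>\<^bsub>poly_ring\<^esub>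
     Idl\<^bsub>poly_ring\<^esub> (range (\<lambda>p. (mvar p)\<^sup>2))"

lemma ideal_inv_sys_ideal: "ideal (inv_sys_ideal L) poly_ring"
proof -
  interpret ring poly_ring
    by (rule ring_from_type_algebra)
  show ?thesis
    unfolding inv_sys_ideal_def stanley_reisner_ideal_def
    by (intro add_ideals genideal_ideal) (auto simp: ring_of_type_algebra_def)
qed

end

theory Submission
  imports Defs "HOL-Library.Function_Algebras"
begin

text \<open>
  By the axiom of a linear space, two lines share at most one point. A squarefree monomial of degree at
  least two with support in a line therefore belongs to just that line, and in degrees \<open>i \<ge> 2\<close> the algebra
  \<open>A\<close> is the direct sum, over the lines \<open>l\<close>, of the degree \<open>i\<close> parts of the algebras
  \<open>K[x\<^sub>p : p \<in> l]/(x\<^sub>p\<^sup>2)\<close>. Multiplication by a linear form \<open>\<ell>\<close> respects this decomposition, so if all lines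
  have \<open>m\<close> points, Lefschetz questions for \<open>A\<close> mostly reduce to \<open>m\<close> variables with squares zero.

  For \<open>m\<close> such variables, with all coefficients of \<open>\<ell>\<close> nonzero, \<open>\<ell>\<^bsup>k\<^esup>\<close> is injective on degree \<open>t\<close> if
  \<open>2 t + k \<le> m\<close> and \<open>1, \<dots>, t + k\<close> are invertible in \<open>K\<close>
  (\<open>lin_mult_pow_injective\<close>), and it is surjective if \<open>2 t + k \<ge> m\<close> and \<open>1, \<dots>, m - t\<close> are
  invertible (\<open>lin_mult_pow_surjective\<close>). Both follow by removing one variable at a time. The range of
  integers is sharp enough to give the bound \<open>\<lceil>m/2\<rceil>\<close> for \<open>k = 1\<close> and \<open>m\<close> for all \<open>k\<close>. Degree zero is
  covered by injectivity. In degree one the condition \<open>2 + j \<le> m\<close> excludes, up to degree \<open>m\<close>, only the map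
  \<open>\<ell>\<^bsup>m-1\<^esup>\<close> into the socle, which is essentially the incidence matrix of points and lines.
  Summing over the \<open>r = (d-1)/(m-1)\<close> lines through a point shows that it is injective once
  \<open>1, \<dots>, r\<close> are invertible (\<open>face_mult_points_to_lines_injective\<close>). A point off a line shows \<open>r \<ge> m\<close>, with
  equality in a projective plane.

  The failures come from \<open>\<ell>\<^bsup>p\<^esup> = 0\<close> in characteristic \<open>p > 0\<close>. If \<open>p \<le> m\<close>, then \<open>\<ell>\<^bsup>p\<^esup>\<close> has not maximal rank
  from degree \<open>0\<close> to degree \<open>p\<close>. If \<open>p \<le> \<lceil>m/2\<rceil>\<close>, then the last nonzero power of \<open>\<ell>\<close> spoils
  injectivity in a degree where the Hilbert function does not decrease
  (\<open>not_maximal_rank_if_small_CHAR\<close>).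

  The polynomial side enters only through \<open>inv_sys_ideal_eq\<close>: the faces index a basis of \<open>A\<close>, and all of
  the above is computed on functions from faces to \<open>K\<close>.
\<close>

section \<open>Multiplication by a linear form modulo squares\<close>

text \<open>A function on subsets of the points stands for the squarefree polynomial with these coefficients.
  Modulo the squares of the variables, multiplication by \<open>\<Sum>\<^sub>p a\<^sub>p x\<^sub>p\<close> becomes this operator: a squarefree
  monomial \<open>x\<^sub>F\<close> arises from \<open>x\<^sub>p\<close> and \<open>x\<^bsub>F - p\<^esub>\<close> only.\<close>

definition lin_mult :: "('p::finite \<Rightarrow> 'k::field) \<Rightarrow> ('p set \<Rightarrow> 'k) \<Rightarrow> 'p set \<Rightarrow> 'k" where
  "lin_mult a u F = (\<Sum>p\<in>F. a p * u (F - {p}))"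

definition concentrated :: "nat \<Rightarrow> ('p set \<Rightarrow> 'k::zero) \<Rightarrow> bool" where
  "concentrated t u \<longleftrightarrow> (\<forall>F. card F \<noteq> t \<longrightarrow> u F = 0)"

lemma lin_mult_pow_Suc:
  "(lin_mult a ^^ Suc k) u F = (\<Sum>p\<in>F. a p * (lin_mult a ^^ k) u (F - {p}))"
  by (simp add: lin_mult_def)

text \<open>The coefficient of a product at \<open>F\<close> sees only the subsets of \<open>F\<close>. Hence the operator restricts to the
  subsets of each line, and one line can be treated at a time.\<close>

lemma lin_mult_pow_cong:
  assumes "\<And>G. G \<subseteq> F \<Longrightarrow> u G = v G"
  shows "(lin_mult a ^^ k) u F = (lin_mult a ^^ k) v F"
  using assms
proof (induction k arbitrary: F)
  case (Suc k)
  have "(lin_mult a ^^ k) u (F - {p}) = (lin_mult a ^^ k) v (F - {p})" for p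
    using Suc.prems by (intro Suc.IH) auto
  then show ?case by (simp only: lin_mult_pow_Suc)
qed auto

lemma lin_mult_pow_linear:
  "(lin_mult a ^^ k) (\<lambda>F. c * u F + d * v F) F
    = c * (lin_mult a ^^ k) u F + d * (lin_mult a ^^ k) v F"
proof (induction k arbitrary: F)
  case (Suc k)
  then show ?case
    by (simp add: lin_mult_def sum_distrib_left sum.distrib algebra_simps)
qed auto

lemma lin_mult_pow_zero [simp]: "(lin_mult a ^^ k) (\<lambda>F. 0) F = 0"
  by (induction k arbitrary: F) (simp_all add: lin_mult_def)

lemma lin_mult_pow_add:
  "(lin_mult a ^^ k) (\<lambda>F. u F + v F) F = (lin_mult a ^^ k) u F + (lin_mult a ^^ k) v F"
  using lin_mult_pow_linear[of k a 1 u 1 v F] by simp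

lemma lin_mult_pow_scale:
  "(lin_mult a ^^ k) (\<lambda>F. c * u F) F = c * (lin_mult a ^^ k) u F"
  using lin_mult_pow_linear[of k a c u 0 u F] by simp

lemma concentrated_lin_mult_pow:
  assumes "concentrated t u"
  shows "concentrated (t + k) ((lin_mult a ^^ k) u)"
proof (induction k)
  case (Suc k)
  have "(lin_mult a ^^ k) u (F - {p}) = 0" if "card F \<noteq> Suc (t + k)" "p \<in> F" for F p
  proof -
    have "card (F - {p}) \<noteq> t + k"
      using that by (metis card_Suc_Diff1 finite)
    then show ?thesis using Suc by (simp add: concentrated_def)
  qed
  then show ?case by (simp add: concentrated_def lin_mult_pow_Suc del: funpow.simps)
qed (simp add: assms)

text \<open>Write \<open>\<ell> = \<ell>' + a\<^sub>x x\<close>. Since \<open>x\<^sup>2 = 0\<close>, the binomial theorem leaves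
  \<open>\<ell>\<^bsup>k+1\<^esup> = \<ell>'\<^bsup>k+1\<^esup> + (k+1) a\<^sub>x x \<ell>'\<^bsup>k\<^esup>\<close>; this is the coefficient of \<open>x\<close> in \<open>\<ell>\<^bsup>k+1\<^esup> u\<close>.\<close>

lemma lin_mult_pow_Suc_insert:
  assumes "x \<notin> F"
  shows "(lin_mult a ^^ Suc k) u (insert x F)
    = (lin_mult a ^^ Suc k) (\<lambda>G. u (insert x G)) F + of_nat (Suc k) * a x * (lin_mult a ^^ k) u F"
  using assms
proof (induction k arbitrary: F)
  case 0
  then have "insert x F - {p} = insert x (F - {p})" if "p \<in> F" for p
    using that by auto
  with 0 show ?case by (simp add: lin_mult_def)
next
  case (Suc k)
  define T where "T = lin_mult a"
  have *: "insert x F - {p} = insert x (F - {p})" if "p \<in> F" for p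
    using that Suc.prems by auto
  have "(T ^^ Suc (Suc k)) u (insert x F)
    = a x * (T ^^ Suc k) u F + (\<Sum>p\<in>F. a p * (T ^^ Suc k) u (insert x (F - {p})))"
  proof -
    have "(T ^^ Suc (Suc k)) u (insert x F)
      = (\<Sum>p\<in>insert x F. a p * (T ^^ Suc k) u (insert x F - {p}))"
      by (simp add: T_def lin_mult_def)
    also have "\<dots> = a x * (T ^^ Suc k) u (insert x F - {x})
       + (\<Sum>p\<in>F. a p * (T ^^ Suc k) u (insert x F - {p}))"
      using Suc.prems by (subst sum.insert) auto
    finally show ?thesis using Suc.prems * by (simp del: funpow.simps)
  qed
  also have "\<dots> = a x * (T ^^ Suc k) u F + (\<Sum>p\<in>F. a p *
       ((T ^^ Suc k) (\<lambda>G. u (insert x G)) (F - {p}) + of_nat (Suc k) * a x * (T ^^ k) u (F - {p})))"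
    using Suc by (simp add: T_def del: funpow.simps)
  also have "\<dots> = a x * (T ^^ Suc k) u F + (T ^^ Suc (Suc k)) (\<lambda>G. u (insert x G)) F
      + of_nat (Suc k) * a x * (T ^^ Suc k) u F"
  proof -
    have "(T ^^ Suc (Suc k)) w F = (\<Sum>p\<in>F. a p * (T ^^ Suc k) w (F - {p}))" for w
      by (simp add: T_def lin_mult_def)
    moreover have "(T ^^ Suc k) u F = (\<Sum>p\<in>F. a p * (T ^^ k) u (F - {p}))"
      by (simp add: T_def lin_mult_def)
    ultimately show ?thesis
      by (simp only: sum_distrib_left sum.distrib distrib_left) (simp add: mult_ac del: funpow.simps)
  qed
  finally show ?case by (simp add: T_def algebra_simps del: funpow.simps)
qed

text \<open>The multinomial theorem without repeated variables: \<open>\<ell>\<^bsup>j\<^esup> = j! \<Sum> a\<^sub>F x\<^sub>F\<close>. In characteristic \<open>p > 0\<close>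
  it gives \<open>\<ell>\<^bsup>p\<^esup> = 0\<close>, the source of all the failures.\<close>

lemma lin_mult_pow_one:
  fixes a :: "'p::finite \<Rightarrow> 'k::field"
  shows "(lin_mult a ^^ j) (\<lambda>F. of_bool (F = {})) F = of_bool (card F = j) * of_nat (fact j) * prod a F"
proof (induction j arbitrary: F)
  case 0
  then show ?case by auto
next
  case (Suc j)
  have "a p * (lin_mult a ^^ j) (\<lambda>F. of_bool (F = {})) (F - {p})
      = of_bool (card F = Suc j) * of_nat (fact j) * prod a F" if "p \<in> F" for p
  proof -
    have "card F = Suc (card (F - {p}))" "prod a F = a p * prod a (F - {p})"
      using that by (simp_all add: prod.remove card_Suc_Diff1 del: card_Diff_insert)
    then show ?thesis unfolding Suc by (simp add: mult_ac)
  qed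
  then have "(lin_mult a ^^ Suc j) (\<lambda>F. of_bool (F = {})) F
      = (\<Sum>p\<in>F. of_bool (card F = Suc j) * of_nat (fact j) * prod a F)"
    unfolding lin_mult_pow_Suc by (rule sum.cong[OF refl])
  then show ?case by (simp add: of_bool_def algebra_simps del: funpow.simps)
qed

text \<open>After the substitution \<open>x\<^sub>p \<mapsto> a\<^sub>p x\<^sub>p\<close>, applying \<open>\<ell>\<^bsup>j\<^esup>\<close> to a linear form means summing its coefficients over
  each face of size \<open>j + 1\<close>, up to the factor \<open>j!\<close>.\<close>

lemma lin_mult_pow_degree_one:
  fixes a :: "'p::finite \<Rightarrow> 'k::field"
  assumes a: "\<And>p. a p \<noteq> 0" and "card F = Suc j"
  shows "(lin_mult a ^^ j) u F = of_nat (fact j) * (\<Sum>p\<in>F. u {p} / a p) * prod a F"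
  using assms(2)
proof (induction j arbitrary: F)
  case 0
  then obtain p where "F = {p}" by (metis One_nat_def card_1_singletonE)
  then show ?case using a by simp
next
  case (Suc j)
  let ?C = "\<Sum>p\<in>F. u {p} / a p"
  have "a p * (lin_mult a ^^ j) u (F - {p}) = of_nat (fact j) * prod a F * (?C - u {p} / a p)"
    if "p \<in> F" for p
  proof -
    have "(lin_mult a ^^ j) u (F - {p}) = of_nat (fact j) * (\<Sum>p\<in>F - {p}. u {p} / a p) * prod a (F - {p})"
      using Suc.prems that by (intro Suc.IH) simp
    moreover have "?C = u {p} / a p + (\<Sum>p\<in>F - {p}. u {p} / a p)" "prod a F = a p * prod a (F - {p})"
      using that by (simp_all add: sum.remove prod.remove)
    ultimately show ?thesis by (simp add: mult_ac)
  qed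
  then have "(lin_mult a ^^ Suc j) u F = (\<Sum>p\<in>F. of_nat (fact j) * prod a F * (?C - u {p} / a p))"
    unfolding lin_mult_pow_Suc by (rule sum.cong[OF refl])
  also have "\<dots> = of_nat (fact j) * prod a F * (of_nat (Suc (Suc j)) * ?C - ?C)"
    using Suc.prems by (simp only: sum_distrib_left[symmetric] sum_subtractf sum_constant)
  finally show ?case by (simp add: algebra_simps)
qed

section \<open>Maximal rank on the subsets of one set\<close>

lemma of_nat_neq_0_below_CHAR:
  assumes "0 < n" "CHAR('k) = 0 \<or> n < CHAR('k)"
  shows "of_nat n \<noteq> (0 :: 'k::semiring_1)"
  using assms by (auto simp: of_nat_eq_0_iff_char_dvd dest: dvd_imp_le)

text \<open>Induction on \<open>S\<close>, removing a variable \<open>x\<close>. Write \<open>\<ell> = \<ell>' + a\<^sub>x x\<close> and \<open>u = g + x h\<close>. Then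
  \<open>\<ell>\<^bsup>k\<^esup> u = 0\<close> says \<open>\<ell>'\<^bsup>k\<^esup> g = 0\<close> and \<open>\<ell>'\<^bsup>k\<^esup> h + k a\<^sub>x \<ell>'\<^bsup>k-1\<^esup> g = 0\<close>. Multiplying the second equation by \<open>\<ell>'\<close>
  gives \<open>\<ell>'\<^bsup>k+1\<^esup> h = 0\<close>, and the hypotheses for \<open>(t, k)\<close> on \<open>S\<close> are those for \<open>(t - 1, k + 1)\<close> on the smaller
  set, so \<open>h = 0\<close>. Dividing by \<open>k a\<^sub>x\<close> leaves \<open>\<ell>'\<^bsup>k-1\<^esup> g = 0\<close>, so \<open>g = 0\<close>. The trade of degree for exponent
  keeps \<open>t + k\<close> fixed, which is why no integer beyond \<open>t + k\<close> has to be inverted.\<close>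

lemma lin_mult_pow_injective:
  fixes a :: "'p::finite \<Rightarrow> 'k::field"
  assumes "\<And>p. p \<in> S \<Longrightarrow> a p \<noteq> 0"
    and "2 * t + k \<le> card S"
    and "\<And>n. 0 < n \<Longrightarrow> n \<le> t + k \<Longrightarrow> of_nat n \<noteq> (0 :: 'k)"
    and "\<And>F. F \<subseteq> S \<Longrightarrow> card F \<noteq> t \<Longrightarrow> u F = 0"
    and "\<And>F. F \<subseteq> S \<Longrightarrow> (lin_mult a ^^ k) u F = 0"
  shows "F \<subseteq> S \<Longrightarrow> u F = 0"
  using finite[of S] assms
proof (induction S arbitrary: t k u F rule: finite_induct)
  case empty
  then show ?case by auto
next
  case (insert x S)
  show ?case
  proof (cases k)
    case 0
    then show ?thesis using insert.prems by auto
  next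
    case (Suc l)
    define h where "h G = u (insert x G)" for G
    have up: "(lin_mult a ^^ Suc l) h G + of_nat (Suc l) * a x * (lin_mult a ^^ l) u G = 0"
      if "G \<subseteq> S" for G
      using insert.prems(6)[of "insert x G"] that insert.hyps Suc
        lin_mult_pow_Suc_insert[of x G l a u] unfolding h_def by fastforce
    \<comment> \<open>\<open>up\<close> and \<open>down\<close> are the parts of \<open>\<ell>\<^bsup>k\<^esup> u = 0\<close> with and without \<open>x\<close>.\<close>
    have down: "(lin_mult a ^^ Suc l) u G = 0" if "G \<subseteq> S" for G
      using insert.prems(6)[of G] that Suc by auto
    have h0: "h G = 0" if "G \<subseteq> S" for G
    proof (cases t)
      case 0
      have "finite G" by simp
      then show ?thesis
        unfolding h_def using 0 that insert.prems(5)[of "insert x G"] by auto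
    next
      case (Suc s)
      show ?thesis
      proof (rule insert.IH[of G s "Suc (Suc l)" h])
        show "(lin_mult a ^^ Suc (Suc l)) h H = 0" if "H \<subseteq> S" for H
        proof -
          have eq: "(lin_mult a ^^ Suc l) h (H - {p})
              = - (of_nat (Suc l) * a x) * (lin_mult a ^^ l) u (H - {p})" for p
            using up[of "H - {p}"] that by (simp add: eq_neg_iff_add_eq_0 Diff_subset subset_trans del: funpow.simps)
              (metis Diff_subset add.commute subset_trans)
          have "(lin_mult a ^^ Suc (Suc l)) h H
            = (\<Sum>p\<in>H. a p * (lin_mult a ^^ Suc l) h (H - {p}))"
            by (simp add: lin_mult_def)
          also have "\<dots> = - (of_nat (Suc l) * a x) * (lin_mult a ^^ Suc l) u H"
            unfolding eq by (simp add: lin_mult_def sum_distrib_left sum_negf mult_ac)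
          finally show ?thesis using down[OF that] by simp
        qed
        show "h H = 0" if "H \<subseteq> S" "card H \<noteq> s" for H
        proof -
          have "x \<notin> H" using that insert.hyps by auto
          then have "card (insert x H) = Suc (card H)" by simp
          then show ?thesis unfolding h_def using that \<open>t = Suc s\<close>
            by (intro insert.prems(5)) auto
        qed
      qed (use that insert.prems(2,3,4) insert.hyps \<open>k = Suc l\<close> \<open>t = Suc s\<close> in auto)
    qed
    have "(lin_mult a ^^ Suc l) h G = 0" if "G \<subseteq> S" for G
      using lin_mult_pow_cong[of G h "\<lambda>_. 0" "Suc l" a] h0 that
      by (metis lin_mult_pow_zero subset_trans)
    moreover have "of_nat (Suc l) * a x \<noteq> 0"
      using insert.prems(2)[of x] insert.prems(4)[of "Suc l"] Suc by auto
    ultimately have "(lin_mult a ^^ l) u G = 0" if "G \<subseteq> S" for G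
      using up[OF that] that by simp
    then have g0: "u G = 0" if "G \<subseteq> S" for G
      using that insert.prems insert.hyps Suc
      by (intro insert.IH[of G t l u]) (auto simp: subset_insertI2 simp del: funpow.simps)
    show ?thesis
    proof (cases "x \<in> F")
      case True
      then have "F = insert x (F - {x})" by auto
      moreover have "h (F - {x}) = 0" using insert.prems(1) by (intro h0) auto
      ultimately show ?thesis unfolding h_def by metis
    next
      case False
      then show ?thesis using g0 insert.prems(1) by auto
    qed
  qed
qed

text \<open>The same induction as for injectivity, dualized. With \<open>v = G + x H\<close>, choose first \<open>g\<close> with
  \<open>k a\<^sub>x \<ell>'\<^bsup>k-1\<^esup> g = H\<close>, then \<open>h\<close> of degree \<open>t - 1\<close> with \<open>\<ell>'\<^bsup>k+1\<^esup> h = G - \<ell>'\<^bsup>k\<^esup> g\<close>. The polynomial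
  \<open>u = g + \<ell>' h - k a\<^sub>x x h\<close> is a preimage: the correction \<open>\<ell>' h\<close> repairs the part without \<open>x\<close>, and the last
  term cancels its effect on the part with \<open>x\<close>.\<close>

lemma lin_mult_pow_surjective:
  fixes a :: "'p::finite \<Rightarrow> 'k::field"
  assumes "\<And>p. p \<in> S \<Longrightarrow> a p \<noteq> 0"
    and "card S \<le> 2 * t + k"
    and "\<And>n. 0 < n \<Longrightarrow> n \<le> card S - t \<Longrightarrow> of_nat n \<noteq> (0 :: 'k)"
    and "concentrated (t + k) v"
  shows "\<exists>u. concentrated t u \<and> (\<forall>F\<subseteq>S. (lin_mult a ^^ k) u F = v F)"
  using finite[of S] assms
proof (induction S arbitrary: t k v rule: finite_induct)
  case empty
  show ?case
  proof (cases k)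
    case 0
    then show ?thesis using empty by auto
  next
    case (Suc l)
    then have "v {} = 0" using empty by (auto simp: concentrated_def)
    moreover have "concentrated t (\<lambda>_ :: 'p set. 0 :: 'k)" by (simp add: concentrated_def)
    ultimately show ?thesis
      by (intro exI[of _ "\<lambda>_. 0"]) (auto simp: subset_insertI2 simp del: funpow.simps)
  qed
next
  case (insert x S)
  have card: "card (insert x S) = Suc (card S)" using insert.hyps by simp
  consider "k = 0" | "t + k > Suc (card S)" | l where "k = Suc l" "t + k \<le> Suc (card S)"
    by (metis not_less old.nat.exhaust)
  then show ?case
  proof cases
    case 1
    then show ?thesis using insert.prems by auto
  next
    case 2
    have "v F = 0" if "F \<subseteq> insert x S" for F
    proof -
      have "card F \<le> Suc (card S)" using that card by (metis card_mono finite)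
      then show ?thesis using insert.prems(4) 2 by (auto simp: concentrated_def)
    qed
    moreover have "concentrated t (\<lambda>_ :: 'p set. 0 :: 'k)" by (simp add: concentrated_def)
    ultimately show ?thesis
      by (intro exI[of _ "\<lambda>_. 0"]) auto
  next
    case (3 l)
    define c where "c = of_nat (Suc l) * a x"
    have c: "c \<noteq> 0"
      using insert.prems(1)[of x] insert.prems(3)[of "Suc l"] 3 card unfolding c_def by auto
    have v: "v F = 0" if "card F \<noteq> t + k" for F
      using insert.prems(4) that by (auto simp: concentrated_def)
    have "concentrated (t + l) (\<lambda>F. if x \<in> F then 0 else v (insert x F) / c)"
      using v 3 by (auto simp: concentrated_def)
    then obtain g where g: "concentrated t g"
      and g_eq: "\<And>F. F \<subseteq> S \<Longrightarrow>
        (lin_mult a ^^ l) g F = (if x \<in> F then 0 else v (insert x F) / c)"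
      using insert.IH[of t l "\<lambda>F. if x \<in> F then 0 else v (insert x F) / c"]
        insert.prems 3 card by (auto simp del: of_nat_Suc)
    \<comment> \<open>Degree \<open>t - 1\<close> is written \<open>Suc (card F) = t\<close>, so that \<open>h = 0\<close> if \<open>t = 0\<close>.\<close>
    obtain h where h: "\<And>F. Suc (card F) \<noteq> t \<Longrightarrow> h F = 0"
      and h_eq: "\<And>F. F \<subseteq> S \<Longrightarrow> (lin_mult a ^^ Suc k) h F = v F - (lin_mult a ^^ k) g F"
    proof (cases t)
      case 0
      have "v F - (lin_mult a ^^ k) g F = 0" if "F \<subseteq> S" for F
      proof -
        have "card F \<le> card S" using that by (simp add: card_mono)
        then have "card F \<noteq> t + k" using 0 insert.prems(2) card by simp
        then show ?thesis using v concentrated_lin_mult_pow[OF g, of k a]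
          by (simp add: concentrated_def)
      qed
      then show ?thesis using that[of "\<lambda>_. 0"] by (simp del: funpow.simps)
    next
      case (Suc s)
      have "concentrated (s + Suc k) (\<lambda>F. v F - (lin_mult a ^^ k) g F)"
        using concentrated_lin_mult_pow[OF g, of k a] v Suc by (simp add: concentrated_def)
      then obtain h where "concentrated s h"
        "\<And>F. F \<subseteq> S \<Longrightarrow> (lin_mult a ^^ Suc k) h F = v F - (lin_mult a ^^ k) g F"
        using insert.IH[of s "Suc k" "\<lambda>F. v F - (lin_mult a ^^ k) g F"]
          insert.prems Suc card by (auto simp del: of_nat_Suc funpow.simps)
      then show ?thesis using that[of h] Suc by (auto simp: concentrated_def)
    qed
    \<comment> \<open>This is \<open>u = g + \<ell>' h - k a\<^sub>x x h\<close>.\<close>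
    define u where "u F = (if x \<in> F then - c * h (F - {x}) else g F + lin_mult a h F)" for F
    have "concentrated t u"
    proof -
      have "u F = 0" if F: "card F \<noteq> t" for F
      proof (cases "x \<in> F")
        case True
        then have "Suc (card (F - {x})) \<noteq> t" using F by (metis card_Suc_Diff1 finite)
        then show ?thesis using h True by (simp add: u_def)
      next
        case False
        have "h (F - {p}) = 0" if "p \<in> F" for p
          using F that by (intro h) (metis card_Suc_Diff1 finite)
        then have "lin_mult a h F = 0" by (simp add: lin_mult_def)
        then show ?thesis using False F g by (simp add: u_def concentrated_def)
      qed
      then show ?thesis by (simp add: concentrated_def)
    qed
    moreover have "(lin_mult a ^^ k) u F = v F" if F: "F \<subseteq> insert x S" for F
    proof -
      have low: "(lin_mult a ^^ n) u G = (lin_mult a ^^ n) g G + (lin_mult a ^^ Suc n) h G"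
        if "G \<subseteq> S" for n G
      proof -
        have "(lin_mult a ^^ n) u G = (lin_mult a ^^ n) (\<lambda>F. g F + lin_mult a h F) G"
          using that insert.hyps by (intro lin_mult_pow_cong) (auto simp: u_def)
        also have "\<dots> = (lin_mult a ^^ n) g G + (lin_mult a ^^ n) (lin_mult a h) G"
          by (rule lin_mult_pow_add)
        finally show ?thesis by (simp add: funpow_swap1)
      qed
      show ?thesis
      proof (cases "x \<in> F")
        case True
        define G where "G = F - {x}"
        have G: "G \<subseteq> S" "x \<notin> G" "F = insert x G" using True F by (auto simp: G_def)
        have "(lin_mult a ^^ Suc l) (\<lambda>H. u (insert x H)) G
          = (lin_mult a ^^ Suc l) (\<lambda>H. - c * h H) G"
        proof (rule lin_mult_pow_cong)
          fix H assume "H \<subseteq> G"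
          then have "insert x H - {x} = H" using G by auto
          then show "u (insert x H) = - c * h H" by (simp add: u_def)
        qed
        also have "\<dots> = - c * (lin_mult a ^^ Suc l) h G" by (rule lin_mult_pow_scale)
        finally have "(lin_mult a ^^ k) u F = c * (lin_mult a ^^ l) g G"
          using lin_mult_pow_Suc_insert[OF G(2), of l a u] low[OF G(1), of l]
          unfolding G(3) \<open>k = Suc l\<close> c_def[symmetric] by (simp add: distrib_left del: funpow.simps)
        also have "\<dots> = v F" using g_eq[OF G(1)] G c by simp
        finally show ?thesis .
      next
        case False
        then have "F \<subseteq> S" using F by auto
        then show ?thesis using low[of F k] h_eq[of F] by simp
      qed
    qed
    ultimately show ?thesis by blast
  qed
qed

section \<open>Squarefree coefficients of polynomials\<close>

definition sqfree_exp :: "'p::finite set \<Rightarrow> ('p \<Rightarrow>\<^sub>0 nat)" where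
  "sqfree_exp F = (\<Sum>p\<in>F. Poly_Mapping.single p 1)"

definition sqfree_coeff :: "('p::finite, 'k::field) mpoly \<Rightarrow> 'p set \<Rightarrow> 'k" where
  "sqfree_coeff f F = Poly_Mapping.lookup f (sqfree_exp F)"

lemma lookup_sqfree_exp: "Poly_Mapping.lookup (sqfree_exp F) p = of_bool (p \<in> F)"
proof -
  have "Poly_Mapping.lookup (sqfree_exp F) p = (\<Sum>q\<in>F. if q = p then 1 else 0)"
    unfolding sqfree_exp_def lookup_sum by (simp add: lookup_single when_def)
  then show ?thesis by simp
qed

lemma sqfree_exp_eq_iff: "sqfree_exp F = sqfree_exp G \<longleftrightarrow> F = G"
proof
  assume "sqfree_exp F = sqfree_exp G"
  then have "(of_bool (p \<in> F) :: nat) = of_bool (p \<in> G)" for p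
    by (metis lookup_sqfree_exp)
  then show "F = G" by (auto simp: of_bool_eq_iff)
qed simp

lemma mon_degree_sqfree_exp: "mon_degree (sqfree_exp F) = card F"
proof -
  have "(\<Sum>p\<in>UNIV. of_bool (p \<in> F) :: nat) = card F"
    by (simp add: of_bool_def sum.If_cases)
  then show ?thesis by (simp add: mon_degree_def lookup_sqfree_exp)
qed

lemma sqfree_exp_empty [simp]: "sqfree_exp {} = 0"
  by (simp add: sqfree_exp_def)

lemma sqfree_exp_remove:
  "p \<in> F \<Longrightarrow> sqfree_exp F = Poly_Mapping.single p 1 + sqfree_exp (F - {p})"
  by (simp add: sqfree_exp_def sum.remove)

lemma eq_sqfree_exp:
  assumes "\<And>p. Poly_Mapping.lookup t p \<le> 1"
  shows "t = sqfree_exp {p. Poly_Mapping.lookup t p = 1}"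
proof (rule poly_mapping_eqI)
  fix p
  show "Poly_Mapping.lookup t p = Poly_Mapping.lookup (sqfree_exp {p. Poly_Mapping.lookup t p = 1}) p"
    using assms[of p] by (auto simp: lookup_sqfree_exp)
qed

lemma add_eq_sqfree_expE:
  assumes "s + t = sqfree_exp F"
  obtains G where "G \<subseteq> F" "t = sqfree_exp G"
proof
  have eq: "Poly_Mapping.lookup s p + Poly_Mapping.lookup t p = of_bool (p \<in> F)" for p
    using assms by (metis lookup_add lookup_sqfree_exp)
  have le: "Poly_Mapping.lookup t p \<le> of_bool (p \<in> F)" for p
    using eq[of p] by linarith
  show "t = sqfree_exp {p. Poly_Mapping.lookup t p = 1}"
  proof (rule eq_sqfree_exp)
    fix p show "Poly_Mapping.lookup t p \<le> 1"
      using le[of p] by (cases "p \<in> F") auto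
  qed
  show "{p. Poly_Mapping.lookup t p = 1} \<subseteq> F"
    using le by (force simp: of_bool_def split: if_splits)
qed

lemma lookup_single_times_add:
  fixes f :: "('p \<Rightarrow>\<^sub>0 nat) \<Rightarrow>\<^sub>0 'k::field"
  shows "Poly_Mapping.lookup (Poly_Mapping.single s c * f) (s + t) = c * Poly_Mapping.lookup f t"
  by (simp add: lookup_mult lookup_single when_mult)

lemma lookup_single_times_eq_0:
  fixes f :: "('p \<Rightarrow>\<^sub>0 nat) \<Rightarrow>\<^sub>0 'k::field"
  assumes "\<And>t. s + t \<noteq> k"
  shows "Poly_Mapping.lookup (Poly_Mapping.single s c * f) k = 0"
proof -
  have "k \<noteq> s + t" for t using assms[of t] by auto
  then show ?thesis by (simp add: lookup_mult lookup_single when_mult)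
qed

lemma sum_singles:
  fixes f :: "'a \<Rightarrow>\<^sub>0 'b::comm_monoid_add"
  shows "(\<Sum>t\<in>Poly_Mapping.keys f. Poly_Mapping.single t (Poly_Mapping.lookup f t)) = f"
proof (rule poly_mapping_eqI)
  fix k
  have "Poly_Mapping.lookup (\<Sum>t\<in>Poly_Mapping.keys f. Poly_Mapping.single t (Poly_Mapping.lookup f t)) k
    = (\<Sum>t\<in>Poly_Mapping.keys f. if t = k then Poly_Mapping.lookup f t else 0)"
    unfolding lookup_sum by (simp add: lookup_single when_def)
  then show "Poly_Mapping.lookup (\<Sum>t\<in>Poly_Mapping.keys f. Poly_Mapping.single t (Poly_Mapping.lookup f t)) k
    = Poly_Mapping.lookup f k"
    by (simp add: in_keys_iff)
qed

lemma sqfree_coeff_linear: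
  "sqfree_coeff 0 F = 0"
  "sqfree_coeff (f + g) F = sqfree_coeff f F + sqfree_coeff g F"
  "sqfree_coeff (- f) F = - sqfree_coeff f F"
  "sqfree_coeff (sum h A) F = (\<Sum>x\<in>A. sqfree_coeff (h x) F)"
  by (simp_all add: sqfree_coeff_def lookup_add lookup_sum)

text \<open>A divisor of a squarefree monomial is squarefree on a smaller support. Polynomials without
  squarefree terms on a downward closed family of supports therefore form an ideal.\<close>

lemma sqfree_coeff_mult_eq_0:
  fixes f g :: "('p::finite, 'k::field) mpoly"
  assumes "\<And>G. G \<subseteq> F \<Longrightarrow> sqfree_coeff f G = 0"
  shows "sqfree_coeff (g * f) F = 0"
proof -
  have "sqfree_coeff (Poly_Mapping.single s c * f) F = 0" for s c
  proof (cases "\<exists>t. s + t = sqfree_exp F")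
    case True
    then obtain t where t: "s + t = sqfree_exp F" by blast
    then obtain G where "G \<subseteq> F" "t = sqfree_exp G" by (rule add_eq_sqfree_expE)
    then have "Poly_Mapping.lookup f t = 0" using assms by (simp add: sqfree_coeff_def)
    then show ?thesis using lookup_single_times_add[of s c f t] t
      by (simp add: sqfree_coeff_def)
  next
    case False
    then show ?thesis by (simp add: sqfree_coeff_def lookup_single_times_eq_0)
  qed
  then have "sqfree_coeff ((\<Sum>t\<in>Poly_Mapping.keys g. Poly_Mapping.single t (Poly_Mapping.lookup g t)) * f) F = 0"
    by (simp add: sum_distrib_right sqfree_coeff_linear)
  then show ?thesis by (simp only: sum_singles)
qed

lemma linear_form_alt:
  "linear_form a = (\<Sum>p\<in>UNIV. Poly_Mapping.single (Poly_Mapping.single p 1) (a p))"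
  by (simp add: linear_form_def mconst_def mvar_def mult_single)

lemma sqfree_coeff_mvar_mult:
  "sqfree_coeff (Poly_Mapping.single (Poly_Mapping.single p 1) c * f) F
    = (if p \<in> F then c * sqfree_coeff f (F - {p}) else 0)"
proof (cases "p \<in> F")
  case True
  then show ?thesis
    by (simp add: sqfree_coeff_def sqfree_exp_remove[of p F] lookup_single_times_add)
next
  case False
  have "Poly_Mapping.single p 1 + t \<noteq> sqfree_exp F" for t
  proof
    assume "Poly_Mapping.single p 1 + t = sqfree_exp F"
    then have "Poly_Mapping.lookup (Poly_Mapping.single p 1 + t) p = 0"
      using False by (simp add: lookup_sqfree_exp)
    then show False by (simp add: lookup_add)
  qed
  then have "sqfree_coeff (Poly_Mapping.single (Poly_Mapping.single p 1) c * f) F = 0"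
    unfolding sqfree_coeff_def by (rule lookup_single_times_eq_0)
  with False show ?thesis by simp
qed

lemma sqfree_coeff_linear_form_mult:
  "sqfree_coeff (linear_form a * f) F = lin_mult a (sqfree_coeff f) F"
proof -
  have "sqfree_coeff (linear_form a * f) F
    = (\<Sum>p\<in>UNIV. if p \<in> F then a p * sqfree_coeff f (F - {p}) else 0)"
    by (simp only: linear_form_alt sum_distrib_right sqfree_coeff_linear sqfree_coeff_mvar_mult)
  also have "\<dots> = lin_mult a (sqfree_coeff f) F"
    unfolding lin_mult_def by (subst sum.inter_restrict[symmetric]) auto
  finally show ?thesis .
qed

lemma sqfree_coeff_linear_form_pow_mult:
  "sqfree_coeff (linear_form a ^ k * f) F = (lin_mult a ^^ k) (sqfree_coeff f) F"
proof (induction k arbitrary: F)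
  case (Suc k)
  have "sqfree_coeff (linear_form a ^ Suc k * f) F = lin_mult a (sqfree_coeff (linear_form a ^ k * f)) F"
    by (simp add: mult.assoc sqfree_coeff_linear_form_mult)
  also have "\<dots> = (lin_mult a ^^ Suc k) (sqfree_coeff f) F"
    by (simp only: lin_mult_pow_Suc Suc.IH lin_mult_def[of a "sqfree_coeff (linear_form a ^ k * f)"])
  finally show ?case .
qed simp

lemma sqfree_coeff_linear_form:
  fixes F :: "'p::finite set"
  shows "sqfree_coeff (linear_form a) F = (\<Sum>p\<in>F. a p * of_bool (F = {p}))"
proof -
  have "sqfree_coeff (linear_form a * 1) F = lin_mult a (sqfree_coeff 1) F"
    by (rule sqfree_coeff_linear_form_mult)
  moreover have "sqfree_coeff 1 G = of_bool (G = {})" for G :: "'p set"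
    using sqfree_exp_eq_iff[of G "{}"] by (simp add: sqfree_coeff_def lookup_one when_def)
  moreover have "a p * of_bool (F - {p} = {}) = a p * of_bool (F = {p})" if "p \<in> F" for p
    using that by (auto simp: of_bool_def)
  ultimately show ?thesis unfolding lin_mult_def mult_1_right by (metis (no_types, lifting) sum.cong)
qed

lemma sqfree_coeff_linear_form_singleton: "sqfree_coeff (linear_form a) {p} = a p"
  by (simp add: sqfree_coeff_linear_form)

lemma prod_mvar: "(\<Prod>p\<in>F. mvar p) = (Poly_Mapping.single (sqfree_exp F) 1 :: ('p::finite, 'k::field) mpoly)"
proof -
  have "finite F" by simp
  then show ?thesis
    by (induction F rule: finite_induct) (auto simp: mvar_def sqfree_exp_def mult_single)
qed

section \<open>The ideal of the inverse system algebra\<close>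

lemma poly_ring_simps [simp]:
  "carrier poly_ring = UNIV" "x \<otimes>\<^bsub>poly_ring\<^esub> y = x * y" "x \<oplus>\<^bsub>poly_ring\<^esub> y = x + y"
  "\<one>\<^bsub>poly_ring\<^esub> = 1" "\<zero>\<^bsub>poly_ring\<^esub> = 0"
  by (simp_all add: ring_of_type_algebra_def)

lemma poly_ring_minus [simp]: "\<ominus>\<^bsub>poly_ring\<^esub> x = - x"
proof -
  interpret ring "poly_ring :: ('p::finite, 'k::field) mpoly ring"
    by (rule ring_from_type_algebra)
  show ?thesis using minus_equality[of "- x" x] by simp
qed

lemma ideal_vanishing_on_faces:
  fixes \<Lambda> :: "'p::finite set set"
  assumes down: "\<And>F G. F \<in> \<Lambda> \<Longrightarrow> G \<subseteq> F \<Longrightarrow> G \<in> \<Lambda>"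
  shows "ideal {f :: ('p, 'k::field) mpoly. \<forall>F\<in>\<Lambda>. sqfree_coeff f F = 0} poly_ring" (is "ideal ?Z _")
proof -
  interpret R: ring "poly_ring :: ('p, 'k) mpoly ring"
    by (rule ring_from_type_algebra)
  have "sqfree_coeff (g * f) F = 0" if "f \<in> ?Z" "F \<in> \<Lambda>" for f g F
    using that down by (intro sqfree_coeff_mult_eq_0) blast
  then have mult: "g * f \<in> ?Z" "f * g \<in> ?Z" if "f \<in> ?Z" for f g
    using that by (auto simp: mult.commute[of f g])
  have "subgroup ?Z (add_monoid poly_ring)"
    by (rule R.add.subgroupI)
      (auto simp: sqfree_coeff_linear a_inv_def[symmetric] intro: exI[of _ 0])
  then show ?thesis
    using mult by (intro idealI R.ring_axioms) auto
qed

lemma subset_face: "F \<in> incidence_complex L \<Longrightarrow> G \<subseteq> F \<Longrightarrow> G \<in> incidence_complex L"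
  by (auto simp: incidence_complex_def)

text \<open>The ideal is spanned by monomials: those with a repeated variable and those whose support is not a
  face. So membership only asks for the squarefree coefficients on faces to vanish, and the faces index
  a basis of the quotient algebra.\<close>

lemma inv_sys_ideal_eq:
  fixes L :: "'p::finite set set"
  shows "(inv_sys_ideal L :: ('p, 'k::field) mpoly set)
    = {f. \<forall>F\<in>incidence_complex L. sqfree_coeff f F = 0}" (is "?I = ?Z")
proof -
  let ?\<Lambda> = "incidence_complex L"
  let ?R = "poly_ring :: ('p, 'k) mpoly ring"
  let ?N = "{\<Prod>p\<in>F. mvar p | F. F \<notin> ?\<Lambda>} :: ('p, 'k) mpoly set"
  let ?Q = "range (\<lambda>p. (mvar p)\<^sup>2) :: ('p, 'k) mpoly set"
  interpret R: ring ?R by (rule ring_from_type_algebra)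
  interpret I: ideal ?I ?R by (rule ideal_inv_sys_ideal)
  have down: "G \<in> ?\<Lambda>" if "F \<in> ?\<Lambda>" "G \<subseteq> F" for F G
    using that by (auto simp: incidence_complex_def)
  interpret Z: ideal ?Z ?R by (rule ideal_vanishing_on_faces) (rule down)
  have mem: "g * f \<in> ?I" if "f \<in> ?I" for f g using I.I_l_closed[OF that, of g] by simp
  show ?thesis
  proof
    have "?N \<subseteq> ?Z"
      by (auto simp: prod_mvar sqfree_coeff_def lookup_single sqfree_exp_eq_iff when_def)
    then have N: "Idl\<^bsub>?R\<^esub> ?N \<subseteq> ?Z" by (intro R.genideal_minimal Z.is_ideal)
    have "sqfree_coeff ((mvar p)\<^sup>2 :: ('p, 'k) mpoly) F = 0" for p F
    proof -
      have "Poly_Mapping.lookup (sqfree_exp F) p \<noteq>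
          Poly_Mapping.lookup (Poly_Mapping.single p 1 + Poly_Mapping.single p 1) p"
        by (simp add: lookup_sqfree_exp lookup_add of_bool_def)
      then have "Poly_Mapping.single p 1 + Poly_Mapping.single p 1 \<noteq> sqfree_exp F" by metis
      then show ?thesis
        by (simp add: power2_eq_square mvar_def mult_single sqfree_coeff_def lookup_single when_def)
    qed
    then have "(mvar p)\<^sup>2 \<in> ?Z" for p by simp
    then have Q: "Idl\<^bsub>?R\<^esub> ?Q \<subseteq> ?Z" by (intro R.genideal_minimal Z.is_ideal) auto
    show "?I \<subseteq> ?Z"
    proof
      fix f assume "f \<in> ?I"
      then obtain g h where gh: "g \<in> Idl\<^bsub>?R\<^esub> ?N" "h \<in> Idl\<^bsub>?R\<^esub> ?Q" "f = g + h"
        unfolding inv_sys_ideal_def stanley_reisner_ideal_def set_add_def' by auto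
      then have "g \<in> ?Z" "h \<in> ?Z" using N Q by blast+
      then show "f \<in> ?Z" using gh(3) by (simp add: sqfree_coeff_linear)
    qed
    have SI: "ideal (Idl\<^bsub>?R\<^esub> ?N) ?R" "ideal (Idl\<^bsub>?R\<^esub> ?Q) ?R"
      by (auto intro!: R.genideal_ideal)
    have gN: "g \<in> ?I" if "g \<in> ?N" for g
    proof -
      have "g \<in> Idl\<^bsub>?R\<^esub> ?N" using R.genideal_self[of ?N] that by auto
      moreover have "0 \<in> Idl\<^bsub>?R\<^esub> ?Q"
        using additive_subgroup.zero_closed[OF ideal.axioms(1)[OF SI(2)]] by simp
      ultimately show ?thesis
        unfolding inv_sys_ideal_def stanley_reisner_ideal_def set_add_def' by force
    qed
    have gQ: "g \<in> ?I" if "g \<in> ?Q" for g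
    proof -
      have "g \<in> Idl\<^bsub>?R\<^esub> ?Q" using R.genideal_self[of ?Q] that by auto
      moreover have "0 \<in> Idl\<^bsub>?R\<^esub> ?N"
        using additive_subgroup.zero_closed[OF ideal.axioms(1)[OF SI(1)]] by simp
      ultimately show ?thesis
        unfolding inv_sys_ideal_def stanley_reisner_ideal_def set_add_def' by force
    qed
    show "?Z \<subseteq> ?I"
    proof
      fix f assume f: "f \<in> ?Z"
      have single: "Poly_Mapping.single t (Poly_Mapping.lookup f t) \<in> ?I" for t
      proof (cases "\<forall>p. Poly_Mapping.lookup t p \<le> 1")
        case True
        then obtain F where t: "t = sqfree_exp F" using eq_sqfree_exp by blast
        show ?thesis
        proof (cases "F \<in> ?\<Lambda>")
          case True
          then have "Poly_Mapping.lookup f t = 0" using f t by (simp add: sqfree_coeff_def)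
          then show ?thesis using I.zero_closed by simp
        next
          case False
          then have "(\<Prod>p\<in>F. mvar p) \<in> ?I" by (intro gN) auto
          then have "mconst (Poly_Mapping.lookup f t) * (\<Prod>p\<in>F. mvar p) \<in> ?I" by (rule mem)
          then show ?thesis by (simp add: prod_mvar mconst_def mult_single t)
        qed
      next
        case False
        then obtain p where p: "2 \<le> Poly_Mapping.lookup t p" by (auto simp: not_le Suc_le_eq numeral_2_eq_2)
        have t: "t = (t - Poly_Mapping.single p 2) + (Poly_Mapping.single p 1 + Poly_Mapping.single p 1)"
          using p by (intro poly_mapping_eqI) (auto simp: lookup_add lookup_minus lookup_single when_def)
        have "(mvar p)\<^sup>2 \<in> ?I" by (intro gQ) auto
        then have "Poly_Mapping.single (t - Poly_Mapping.single p 2) (Poly_Mapping.lookup f t) * (mvar p)\<^sup>2 \<in> ?I"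
          by (rule mem)
        then show ?thesis by (subst t) (simp add: mvar_def mult_single power2_eq_square)
      qed
      have "sum g A \<in> ?I" if "finite A" "\<And>t. g t \<in> ?I" for g and A :: "('p \<Rightarrow>\<^sub>0 nat) set"
        using that(1)
      proof (induction A rule: finite_induct)
        case empty
        then show ?case using I.zero_closed by simp
      next
        case (insert x A)
        then show ?case using I.a_closed[of "g x" "sum g A"] that(2) by simp
      qed
      from this[of "Poly_Mapping.keys f" "\<lambda>t. Poly_Mapping.single t (Poly_Mapping.lookup f t)"] single
      show "f \<in> ?I" by (simp add: sum_singles)
    qed
  qed
qed

section \<open>The graded pieces in the basis of faces\<close>

text \<open>Coordinates of the degree \<open>i\<close> part of the algebra with respect to the basis of faces.\<close>

definition face_vectors :: "'p set set \<Rightarrow> nat \<Rightarrow> ('p::finite set \<Rightarrow> 'k::field) set" where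
  "face_vectors L i = {u. \<forall>F. u F \<noteq> 0 \<longrightarrow> F \<in> incidence_complex L \<and> card F = i}"

definition vec_poly :: "('p::finite set \<Rightarrow> 'k::field) \<Rightarrow> ('p, 'k) mpoly" where
  "vec_poly u = (\<Sum>F\<in>UNIV. Poly_Mapping.single (sqfree_exp F) (u F))"

definition vec_class :: "'p::finite set set \<Rightarrow> ('p set \<Rightarrow> 'k::field) \<Rightarrow> ('p, 'k) mpoly set" where
  "vec_class L u = inv_sys_ideal L +>\<^bsub>poly_ring\<^esub> vec_poly u"

text \<open>Multiplication by the \<open>j\<close>-th power of a linear form in these coordinates. Terms outside the complex lie
  in the ideal and are cut off.\<close>

definition face_mult ::
    "'p::finite set set \<Rightarrow> ('p \<Rightarrow> 'k::field) \<Rightarrow> nat \<Rightarrow> ('p set \<Rightarrow> 'k) \<Rightarrow> 'p set \<Rightarrow> 'k" where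
  "face_mult L a j u F = (if F \<in> incidence_complex L then (lin_mult a ^^ j) u F else 0)"

lemma sqfree_coeff_vec_poly [simp]: "sqfree_coeff (vec_poly u) = u"
proof
  fix F :: "'a set"
  have "sqfree_coeff (vec_poly u) F = (\<Sum>G\<in>UNIV. if G = F then u G else 0)"
    unfolding sqfree_coeff_def vec_poly_def lookup_sum
    by (simp add: lookup_single when_def sqfree_exp_eq_iff)
  then show "sqfree_coeff (vec_poly u) F = u F" by simp
qed

lemma homogeneous_vec_poly:
  assumes "u \<in> face_vectors L i"
  shows "homogeneous i (vec_poly u)"
proof -
  have "mon_degree t = i" if "Poly_Mapping.lookup (vec_poly u) t \<noteq> 0" for t
  proof -
    have "(\<Sum>F\<in>UNIV. Poly_Mapping.lookup (Poly_Mapping.single (sqfree_exp F) (u F)) t) \<noteq> 0"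
      using that by (simp add: vec_poly_def lookup_sum)
    then obtain F where "Poly_Mapping.lookup (Poly_Mapping.single (sqfree_exp F) (u F)) t \<noteq> 0"
      by (rule sum.not_neutral_contains_not_neutral)
    then have "t = sqfree_exp F" "u F \<noteq> 0" by (auto simp: lookup_single when_def split: if_splits)
    then show ?thesis using assms by (simp add: face_vectors_def mon_degree_sqfree_exp)
  qed
  then show ?thesis by (simp add: homogeneous_def in_keys_iff)
qed

lemma zero_in_face_vectors [simp]: "(\<lambda>_. 0) \<in> face_vectors L i"
  by (simp add: face_vectors_def)

lemma face_mult_in: "u \<in> face_vectors L i \<Longrightarrow> face_mult L a j u \<in> face_vectors L (i + j)"
  using concentrated_lin_mult_pow[of i u j a]
  by (auto simp: face_vectors_def face_mult_def concentrated_def split: if_splits)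

lemma face_mult_zero: "face_mult L a j (\<lambda>_. 0) = (\<lambda>_. 0)"
  by (simp add: face_mult_def fun_eq_iff)

text \<open>Cutting off nonfaces commutes with multiplication since subsets of faces are faces.\<close>

lemma face_mult_1_face_mult: "face_mult L a 1 (face_mult L a j u) = face_mult L a (Suc j) u"
proof
  fix F
  have "lin_mult a (face_mult L a j u) F = (lin_mult a ^^ Suc j) u F" if "F \<in> incidence_complex L"
    unfolding lin_mult_pow_Suc unfolding lin_mult_def face_mult_def
    using subset_face[OF that] by (intro sum.cong) auto
  then show "face_mult L a 1 (face_mult L a j u) F = face_mult L a (Suc j) u F"
    by (simp add: face_mult_def)
qed

lemma face_mult_pow_CHAR_eq_0:
  assumes "0 < CHAR('k::field)" "u \<in> face_vectors L 0"
  shows "face_mult L (a :: 'p::finite \<Rightarrow> 'k) CHAR('k) u = (\<lambda>_. 0)"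
proof -
  have "of_nat (fact CHAR('k)) = (0 :: 'k)"
    using assms(1) of_nat_eq_0_iff_char_dvd[of "fact CHAR('k)", where ?'a = 'k]
    by (simp add: dvd_fact)
  then have *: "face_mult L a CHAR('k) (\<lambda>F. c * of_bool (F = {})) = (\<lambda>_. 0)" for c
    by (simp add: face_mult_def fun_eq_iff lin_mult_pow_scale lin_mult_pow_one)
  have "u = (\<lambda>F. u {} * of_bool (F = {}))"
    using assms(2) by (auto simp: face_vectors_def fun_eq_iff of_bool_def)
  then show ?thesis using *[of "u {}"] by metis
qed

lemma inj_on_face_multI:
  assumes "\<And>u. u \<in> face_vectors L i \<Longrightarrow> face_mult L a j u = (\<lambda>_. 0) \<Longrightarrow> u = (\<lambda>_. 0)"
  shows "inj_on (face_mult L a j) (face_vectors L i)"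
proof (rule inj_onI)
  fix u v assume u: "u \<in> face_vectors L i" "v \<in> face_vectors L i" "face_mult L a j u = face_mult L a j v"
  let ?w = "\<lambda>F. 1 * u F + (- 1) * v F"
  have "face_mult L a j ?w F = face_mult L a j u F - face_mult L a j v F" for F
    unfolding face_mult_def lin_mult_pow_linear by simp
  then have "face_mult L a j ?w = (\<lambda>_. 0)" using u(3) by (simp add: fun_eq_iff)
  moreover have "?w \<in> face_vectors L i"
  proof -
    have "F \<in> incidence_complex L \<and> card F = i" if "?w F \<noteq> 0" for F
      using that u(1,2) by (cases "u F = 0") (auto simp: face_vectors_def)
    then show ?thesis unfolding face_vectors_def by blast
  qed
  ultimately have "?w = (\<lambda>_. 0)" by (rule assms[rotated])
  then have "?w F = 0" for F by metis
  then show "u = v" by (simp add: fun_eq_iff)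
qed

context
  fixes L :: "'p::finite set set" and I :: "('p, 'k::field) mpoly set"
  assumes I: "I = inv_sys_ideal L"
begin

lemma coset_eq:
  "I +>\<^bsub>poly_ring\<^esub> f = {g. \<forall>F\<in>incidence_complex L. sqfree_coeff g F = sqfree_coeff f F}"
proof -
  have "g \<in> I +>\<^bsub>poly_ring\<^esub> f \<longleftrightarrow> (\<exists>h\<in>I. g = h + f)" for g
    by (auto simp: a_r_coset_def r_coset_def ring_of_type_algebra_def)
  also have "\<dots>g \<longleftrightarrow> g - f \<in> I" for g by (auto intro: bexI[of _ "g - f"])
  also have "\<dots>g \<longleftrightarrow> (\<forall>F\<in>incidence_complex L. sqfree_coeff g F = sqfree_coeff f F)" for g
    unfolding I inv_sys_ideal_eq by (simp add: sqfree_coeff_def lookup_minus)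
  finally show ?thesis by blast
qed

lemma coset_eq_iff:
  "I +>\<^bsub>poly_ring\<^esub> f = I +>\<^bsub>poly_ring\<^esub> g
    \<longleftrightarrow> (\<forall>F\<in>incidence_complex L. sqfree_coeff f F = sqfree_coeff g F)"
  unfolding coset_eq by auto

lemma quot_zero: "\<zero>\<^bsub>quot_alg I\<^esub> = I +>\<^bsub>poly_ring\<^esub> 0"
  unfolding coset_eq by (simp add: quot_alg_def FactRing_def I inv_sys_ideal_eq sqfree_coeff_linear)

lemma quot_mult:
  "(I +>\<^bsub>poly_ring\<^esub> f) \<otimes>\<^bsub>quot_alg I\<^esub> (I +>\<^bsub>poly_ring\<^esub> g) = I +>\<^bsub>poly_ring\<^esub> (f * g)"
proof -
  interpret ideal I poly_ring unfolding I by (rule ideal_inv_sys_ideal)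
  show ?thesis
    using rcoset_mult_add[of f g] by (simp add: quot_alg_def FactRing_def)
qed

lemma quot_carrier: "carrier (quot_alg I) = range (\<lambda>f. I +>\<^bsub>poly_ring\<^esub> f)"
  by (auto simp: quot_alg_def FactRing_def A_RCOSETS_def RCOSETS_def a_r_coset_def
      ring_of_type_algebra_def)

lemma quot_pow:
  "(I +>\<^bsub>poly_ring\<^esub> f) [^]\<^bsub>quot_alg I\<^esub> (j::nat) = I +>\<^bsub>poly_ring\<^esub> (f ^ j)"
proof -
  interpret ideal I poly_ring unfolding I by (rule ideal_inv_sys_ideal)
  interpret Q: ring "quot_alg I" unfolding quot_alg_def by (rule quotient_is_ring)
  have "\<one>\<^bsub>quot_alg I\<^esub> = I +>\<^bsub>poly_ring\<^esub> 1" by (simp add: quot_alg_def FactRing_def)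
  then show ?thesis
    by (induction j) (simp_all add: quot_mult mult.commute)
qed

lemma coset_eq_vec_class:
  "I +>\<^bsub>poly_ring\<^esub> f = vec_class L u \<longleftrightarrow> (\<forall>F\<in>incidence_complex L. sqfree_coeff f F = u F)"
  unfolding vec_class_def I[symmetric] coset_eq_iff by simp

lemma vec_class_eq_iff:
  assumes "u \<in> face_vectors L i" "v \<in> face_vectors L j"
  shows "(vec_class L u :: ('p, 'k) mpoly set) = vec_class L v \<longleftrightarrow> u = v"
proof -
  have "u = v" if "\<forall>F\<in>incidence_complex L. u F = v F"
    using that assms by (intro ext) (auto simp: face_vectors_def, metis)
  then show ?thesis
    unfolding vec_class_def I[symmetric] coset_eq_iff by auto
qed

lemma graded_piece_eq: "graded_piece I i = vec_class L ` face_vectors L i"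
proof
  show "graded_piece I i \<subseteq> vec_class L ` face_vectors L i"
  proof
    fix \<alpha> assume "\<alpha> \<in> graded_piece I i"
    then obtain f where f: "homogeneous i f" "\<alpha> = I +>\<^bsub>poly_ring\<^esub> f"
      by (auto simp: graded_piece_def)
    define u where "u F = (if F \<in> incidence_complex L then sqfree_coeff f F else 0)" for F
    have "card F = i" if "sqfree_coeff f F \<noteq> 0" for F
      using f(1) that unfolding sqfree_coeff_def
      by (metis homogeneous_def in_keys_iff mon_degree_sqfree_exp)
    then have "u \<in> face_vectors L i"
      by (simp add: u_def face_vectors_def)
    moreover have "\<alpha> = vec_class L u"
      unfolding f(2) coset_eq_vec_class by (simp add: u_def)
    ultimately show "\<alpha> \<in> vec_class L ` face_vectors L i" by blast
  qed
  show "vec_class L ` face_vectors L i \<subseteq> graded_piece I i"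
    unfolding graded_piece_def vec_class_def I[symmetric] using homogeneous_vec_poly by blast
qed

lemma form_pow_mult_vec_class:
  "((I +>\<^bsub>poly_ring\<^esub> linear_form a) [^]\<^bsub>quot_alg I\<^esub> (j::nat)) \<otimes>\<^bsub>quot_alg I\<^esub> vec_class L u
    = vec_class L (face_mult L a j u)"
proof -
  have "((I +>\<^bsub>poly_ring\<^esub> linear_form a) [^]\<^bsub>quot_alg I\<^esub> j) \<otimes>\<^bsub>quot_alg I\<^esub> vec_class L u
    = I +>\<^bsub>poly_ring\<^esub> (linear_form a ^ j * vec_poly u)"
    by (simp add: vec_class_def I[symmetric] quot_pow quot_mult)
  also have "\<dots> = vec_class L (face_mult L a j u)"
    unfolding coset_eq_vec_class by (simp add: sqfree_coeff_linear_form_pow_mult face_mult_def)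
  finally show ?thesis .
qed

text \<open>The classes of face vectors identify both graded pieces with coordinate spaces, and multiplication by
  a power of a linear form becomes \<^const>\<open>face_mult\<close>.\<close>

lemma maximal_rank_form_pow_iff:
  "maximal_rank (\<lambda>\<alpha>. ((I +>\<^bsub>poly_ring\<^esub> linear_form a) [^]\<^bsub>quot_alg I\<^esub> (j::nat)) \<otimes>\<^bsub>quot_alg I\<^esub> \<alpha>)
      (graded_piece I i) (graded_piece I (i + j))
    \<longleftrightarrow> maximal_rank (face_mult L a j) (face_vectors L i) (face_vectors L (i + j))"
proof -
  let ?V = "face_vectors L i :: ('p set \<Rightarrow> 'k) set"
    and ?W = "face_vectors L (i + j) :: ('p set \<Rightarrow> 'k) set"
    and ?c = "vec_class L :: _ \<Rightarrow> ('p, 'k) mpoly set" and ?T = "face_mult L a j"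
  let ?M = "\<lambda>\<alpha>. ((I +>\<^bsub>poly_ring\<^esub> linear_form a) [^]\<^bsub>quot_alg I\<^esub> j) \<otimes>\<^bsub>quot_alg I\<^esub> \<alpha>"
  have T: "?T ` ?V \<subseteq> ?W" using face_mult_in by blast
  have inj: "inj_on ?c ?V" "inj_on ?c ?W"
    using vec_class_eq_iff by (auto intro!: inj_onI)
  have comp: "?M \<circ> ?c = ?c \<circ> ?T"
    by (rule ext) (simp add: form_pow_mult_vec_class)
  have "inj_on ?M (?c ` ?V) \<longleftrightarrow> inj_on (?M \<circ> ?c) ?V"
    using inj(1) by (metis comp_inj_on_iff)
  also have "\<dots> \<longleftrightarrow> inj_on ?T ?V"
    unfolding comp using inj(2) T by (meson comp_inj_on inj_on_imageI2 inj_on_subset)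
  finally have 1: "inj_on ?M (?c ` ?V) \<longleftrightarrow> inj_on ?T ?V" .
  have "?M ` (?c ` ?V) = ?c ` (?T ` ?V)"
    unfolding image_comp comp ..
  then have "?M ` (?c ` ?V) = ?c ` ?W \<longleftrightarrow> ?T ` ?V = ?W"
    using inj_on_image_eq_iff[OF inj(2) T] by simp
  with 1 show ?thesis unfolding maximal_rank_def graded_piece_eq by blast
qed

lemma maximal_rank_form_iff:
  "maximal_rank (\<lambda>\<alpha>. (I +>\<^bsub>poly_ring\<^esub> linear_form a) \<otimes>\<^bsub>quot_alg I\<^esub> \<alpha>)
      (graded_piece I i) (graded_piece I (i + 1))
    \<longleftrightarrow> maximal_rank (face_mult L a 1) (face_vectors L i) (face_vectors L (i + 1))"
  using maximal_rank_form_pow_iff[of a 1 i] unfolding quot_pow by simp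

lemma graded_piece_1: "graded_piece I 1 = range (\<lambda>a. I +>\<^bsub>poly_ring\<^esub> linear_form a)"
proof
  show "graded_piece I 1 \<subseteq> range (\<lambda>a. I +>\<^bsub>poly_ring\<^esub> linear_form a)"
  proof
    fix \<alpha> assume "\<alpha> \<in> graded_piece I 1"
    then obtain u where u: "u \<in> face_vectors L 1" "\<alpha> = vec_class L u"
      unfolding graded_piece_eq by blast
    have "sqfree_coeff (linear_form (\<lambda>p. u {p})) F = u F" for F
    proof (cases "card F = 1")
      case True
      then obtain p where "F = {p}" by (metis card_1_singletonE)
      then show ?thesis by (simp add: sqfree_coeff_linear_form)
    next
      case False
      then have "F \<noteq> {p}" for p by auto
      moreover have "u F = 0" using u(1) False by (auto simp: face_vectors_def)
      ultimately show ?thesis by (simp add: sqfree_coeff_linear_form)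
    qed
    then have "\<alpha> = I +>\<^bsub>poly_ring\<^esub> linear_form (\<lambda>p. u {p})"
      using coset_eq_vec_class[of "linear_form (\<lambda>p. u {p})" u] u(2) by simp
    then show "\<alpha> \<in> range (\<lambda>a. I +>\<^bsub>poly_ring\<^esub> linear_form a)" by blast
  qed
  have "homogeneous 1 (linear_form a)" for a :: "'p \<Rightarrow> 'k"
  proof -
    have "mon_degree t = 1" if "t \<in> Poly_Mapping.keys (linear_form a)" for t
    proof -
      have "(\<Sum>p\<in>UNIV. Poly_Mapping.lookup (Poly_Mapping.single (Poly_Mapping.single p 1) (a p)) t) \<noteq> 0"
        using that by (simp add: linear_form_alt lookup_sum in_keys_iff)
      then obtain p where "Poly_Mapping.lookup (Poly_Mapping.single (Poly_Mapping.single p 1) (a p)) t \<noteq> 0"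
        by (rule sum.not_neutral_contains_not_neutral)
      then have "t = sqfree_exp {p}"
        by (auto simp: lookup_single when_def sqfree_exp_def split: if_splits)
      then show ?thesis by (simp add: mon_degree_sqfree_exp)
    qed
    then show ?thesis by (simp add: homogeneous_def)
  qed
  then show "range (\<lambda>a. I +>\<^bsub>poly_ring\<^esub> linear_form a) \<subseteq> graded_piece I 1"
    by (auto simp: graded_piece_def)
qed

lemma general_form_imp_exists:
  assumes "holds_for_general_form I Q"
  obtains a where "Q (I +>\<^bsub>poly_ring\<^esub> linear_form a)"
proof -
  obtain U where "zariski_open_forms I U" "U \<noteq> {}" "\<forall>l\<in>U. Q l"
    using assms by (auto simp: holds_for_general_form_def)
  then show ?thesis
    using that unfolding zariski_open_forms_def graded_piece_1 by blast
qed

text \<open>The open set used for every positive statement consists of the forms with no vanishing coefficient. It is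
  the nonvanishing locus of the product of all variables, and it contains the sum of the variables. Points are
  faces, so a class in degree one determines its coefficients.\<close>

lemma general_formI:
  assumes "\<And>p. {p} \<in> incidence_complex L"
    and "\<And>a. (\<And>p. a p \<noteq> 0) \<Longrightarrow> Q (I +>\<^bsub>poly_ring\<^esub> linear_form a)"
  shows "holds_for_general_form I Q"
proof -
  define U where "U = {I +>\<^bsub>poly_ring\<^esub> linear_form a | a. \<forall>p. a p \<noteq> 0}"
  have inj: "a = b" if "I +>\<^bsub>poly_ring\<^esub> linear_form a = I +>\<^bsub>poly_ring\<^esub> linear_form b" for a b
    using that assms(1) unfolding coset_eq_iff by (metis ext sqfree_coeff_linear_form_singleton)
  have "{a. I +>\<^bsub>poly_ring\<^esub> linear_form a \<in> U} = {a. \<forall>p. a p \<noteq> 0}"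
    using inj by (auto simp: U_def)
  also have "\<dots> = {a. \<exists>f\<in>{\<Prod>p\<in>UNIV. mvar p}. meval f a \<noteq> 0}"
    unfolding prod_mvar meval_def by (simp add: lookup_sqfree_exp)
  finally have "zariski_open {a. I +>\<^bsub>poly_ring\<^esub> linear_form a \<in> U}"
    unfolding zariski_open_def by blast
  then have "zariski_open_forms I U"
    unfolding zariski_open_forms_def graded_piece_1 by (auto simp: U_def)
  moreover have "I +>\<^bsub>poly_ring\<^esub> linear_form (\<lambda>_. 1) \<in> U" by (auto simp: U_def)
  moreover have "Q l" if "l \<in> U" for l using that assms(2) by (auto simp: U_def)
  ultimately show ?thesis unfolding holds_for_general_form_def by blast
qed

lemma WLP_I:
  assumes "\<And>p. {p} \<in> incidence_complex L"
    and "\<And>(a :: 'p \<Rightarrow> 'k) i. (\<And>p. a p \<noteq> 0) \<Longrightarrow>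
      maximal_rank (face_mult L a 1) (face_vectors L i) (face_vectors L (i + 1))"
  shows "WLP I"
  unfolding WLP_def by (intro general_formI assms(1) allI maximal_rank_form_iff[THEN iffD2] assms(2))

lemma WLP_E:
  assumes "WLP I"
  obtains a :: "'p \<Rightarrow> 'k" where
    "\<And>i. maximal_rank (face_mult L a 1) (face_vectors L i) (face_vectors L (i + 1))"
  using general_form_imp_exists[OF assms[unfolded WLP_def]] maximal_rank_form_iff by metis

lemma SLP_I:
  assumes "\<And>p. {p} \<in> incidence_complex L"
    and "\<And>(a :: 'p \<Rightarrow> 'k) i j. (\<And>p. a p \<noteq> 0) \<Longrightarrow>
      maximal_rank (face_mult L a j) (face_vectors L i) (face_vectors L (i + j))"
  shows "SLP I"
  unfolding SLP_def by (intro general_formI assms(1) allI maximal_rank_form_pow_iff[THEN iffD2] assms(2))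

lemma SLP_E:
  assumes "SLP I"
  obtains a :: "'p \<Rightarrow> 'k" where
    "\<And>i j. maximal_rank (face_mult L a j) (face_vectors L i) (face_vectors L (i + j))"
  using general_form_imp_exists[OF assms[unfolded SLP_def]] maximal_rank_form_pow_iff by metis

text \<open>Testing against the variables: \<open>x\<^sub>p\<close> moves the coefficient at \<open>F\<close> to \<open>insert p F\<close>, if that is a face.\<close>

lemma socle_eq:
  "socle I = {I +>\<^bsub>poly_ring\<^esub> f | f.
    \<forall>F p. p \<notin> F \<longrightarrow> insert p F \<in> incidence_complex L \<longrightarrow> sqfree_coeff f F = 0}"
proof -
  have "(\<forall>x\<in>graded_piece I 1. x \<otimes>\<^bsub>quot_alg I\<^esub> (I +>\<^bsub>poly_ring\<^esub> f) = \<zero>\<^bsub>quot_alg I\<^esub>)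
    \<longleftrightarrow> (\<forall>F p. p \<notin> F \<longrightarrow> insert p F \<in> incidence_complex L \<longrightarrow> sqfree_coeff f F = 0)" (is "?l \<longleftrightarrow> ?r") for f
  proof -
    have "?l \<longleftrightarrow> (\<forall>a. \<forall>F\<in>incidence_complex L. lin_mult a (sqfree_coeff f) F = 0)"
      unfolding graded_piece_1
      by (simp add: quot_mult quot_zero coset_eq_iff sqfree_coeff_linear sqfree_coeff_linear_form_mult)
    also have "\<dots> \<longleftrightarrow> ?r"
    proof
      assume l: "\<forall>a. \<forall>F\<in>incidence_complex L. lin_mult a (sqfree_coeff f) F = 0"
      show ?r
      proof (intro allI impI)
        fix F p assume p: "p \<notin> F" "insert p F \<in> incidence_complex L"
        have "0 = lin_mult (\<lambda>q. if q = p then 1 else 0) (sqfree_coeff f) (insert p F)"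
          using l p by simp
        also have "\<dots> = (\<Sum>q\<in>insert p F. if q = p then sqfree_coeff f (insert p F - {q}) else 0)"
          unfolding lin_mult_def by (intro sum.cong) auto
        also have "\<dots> = sqfree_coeff f F" using p by simp
        finally show "sqfree_coeff f F = 0" by simp
      qed
    next
      assume r: ?r
      have "sqfree_coeff f (F - {p}) = 0" if "p \<in> F" "F \<in> incidence_complex L" for F p
        using r[rule_format, of p "F - {p}"] that by (simp add: insert_absorb)
      then show "\<forall>a. \<forall>F\<in>incidence_complex L. lin_mult a (sqfree_coeff f) F = 0"
        by (simp add: lin_mult_def)
    qed
    finally show ?thesis .
  qed
  then show ?thesis unfolding socle_def quot_carrier by blast
qed

end

section \<open>Linear spaces\<close>

lemma linear_space_line_unique:
  fixes L :: "'p::finite set set"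
  assumes "linear_space L" "l \<in> L" "l' \<in> L" "F \<subseteq> l" "F \<subseteq> l'" "2 \<le> card F"
  shows "l = l'"
proof -
  obtain a b where "a \<in> F" "b \<in> F" "a \<noteq> b"
    using assms(6) by (metis One_nat_def card_le_Suc0_iff_eq finite not_less_eq_eq numeral_2_eq_2)
  then show ?thesis
    using assms unfolding linear_space_def by (metis subsetD)
qed

lemma linear_space_ex1_line:
  "linear_space L \<Longrightarrow> a \<noteq> b \<Longrightarrow> \<exists>!l. l \<in> L \<and> a \<in> l \<and> b \<in> l"
  by (auto simp: linear_space_def)

lemma singleton_face:
  fixes L :: "'p::finite set set"
  assumes "linear_space L" "L \<noteq> {}"
  shows "{p} \<in> incidence_complex L"
proof -
  obtain l where l: "l \<in> L" using assms(2) by blast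
  then have "2 \<le> card l" using assms(1) by (auto simp: linear_space_def)
  then obtain q where "q \<noteq> p"
    by (metis One_nat_def card_le_Suc0_iff_eq finite not_less_eq_eq numeral_2_eq_2)
  then obtain l' where "l' \<in> L" "p \<in> l'"
    using linear_space_ex1_line[OF assms(1)] by metis
  then show ?thesis by (auto simp: incidence_complex_def)
qed

lemma pencil_partition:
  fixes L :: "'p::finite set set"
  assumes "linear_space L"
  shows "(\<Union>l\<in>{l\<in>L. p \<in> l}. l - {p}) = UNIV - {p}"
    and "\<forall>l\<in>{l\<in>L. p \<in> l}. \<forall>l'\<in>{l\<in>L. p \<in> l}. l \<noteq> l' \<longrightarrow> (l - {p}) \<inter> (l' - {p}) = {}"
proof -
  have "\<exists>l\<in>L. p \<in> l \<and> q \<in> l" if "q \<noteq> p" for q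
    using linear_space_ex1_line[OF assms that[symmetric]] by auto
  then show "(\<Union>l\<in>{l\<in>L. p \<in> l}. l - {p}) = UNIV - {p}"
    by auto
  show "\<forall>l\<in>{l\<in>L. p \<in> l}. \<forall>l'\<in>{l\<in>L. p \<in> l}. l \<noteq> l' \<longrightarrow> (l - {p}) \<inter> (l' - {p}) = {}"
  proof (intro ballI impI equals0I)
    fix l l' q assume "l \<in> {l\<in>L. p \<in> l}" "l' \<in> {l\<in>L. p \<in> l}" "l \<noteq> l'" "q \<in> (l - {p}) \<inter> (l' - {p})"
    then show False
      using linear_space_ex1_line[OF assms, of p q] by auto
  qed
qed

text \<open>Summing over the lines of the pencil of \<open>p\<close> counts \<open>p\<close> once for each line and every other point
  once; the summand \<open>c p\<close> on the left completes the sum over all points.\<close>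

lemma pencil_sum:
  fixes L :: "'p::finite set set" and c :: "'p \<Rightarrow> 'b::comm_ring_1"
  assumes "linear_space L"
  shows "(\<Sum>l\<in>{l\<in>L. p \<in> l}. sum c l) + c p
    = of_nat (card {l\<in>L. p \<in> l}) * c p + sum c UNIV"
proof -
  have "(\<Sum>l\<in>{l\<in>L. p \<in> l}. sum c l) = (\<Sum>l\<in>{l\<in>L. p \<in> l}. c p + sum c (l - {p}))"
    by (intro sum.cong) (auto simp: sum.remove)
  also have "\<dots> = of_nat (card {l\<in>L. p \<in> l}) * c p + sum c (UNIV - {p})"
    using sum.UNION_disjoint[of "{l\<in>L. p \<in> l}" "\<lambda>l. l - {p}" c] pencil_partition[OF assms, of p]
    by (simp add: sum.distrib)
  finally show ?thesis by (simp add: sum.remove[of UNIV p c])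
qed

text \<open>The monomial of a line lies in the socle, for a line is contained in no other line.\<close>

lemma uniform_if_level:
  fixes L :: "'p::finite set set" and I :: "('p, 'k::field) mpoly set"
  assumes ls: "linear_space L" and I: "I = inv_sys_ideal L"
    and level: "level_of_socle_degree I m" and l: "l \<in> L"
  shows "card l = m"
proof -
  let ?x = "\<lambda>F. of_bool (F = l) :: 'k"
  have x: "?x \<in> face_vectors L (card l)"
    using l by (auto simp: face_vectors_def incidence_complex_def)
  have "?x F = 0" if "p \<notin> F" "insert p F \<in> incidence_complex L" for F p
  proof -
    from that(2) obtain l' where l': "l' \<in> L" "insert p F \<subseteq> l'"
      by (auto simp: incidence_complex_def)
    have "F \<noteq> l"
    proof
      assume "F = l"
      moreover have "2 \<le> card l" using ls l by (simp add: linear_space_def)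
      ultimately have "l = l'" using linear_space_line_unique[OF ls l l'(1), of l] l'(2) by auto
      then show False using \<open>F = l\<close> that(1) l'(2) by auto
    qed
    then show ?thesis by simp
  qed
  then have "vec_class L ?x \<in> socle I"
    unfolding socle_eq[OF I] vec_class_def I[symmetric]
    by (auto intro!: exI[of _ "vec_poly ?x"])
  then have "vec_class L ?x \<in> (vec_class L ` face_vectors L m :: ('p, 'k) mpoly set set)"
    using level unfolding level_of_socle_degree_def graded_piece_eq[OF I] by simp
  then obtain u where "u \<in> face_vectors L m" "vec_class L ?x = (vec_class L u :: ('p, 'k) mpoly set)"
    by blast
  then have "?x \<in> face_vectors L m" using vec_class_eq_iff[OF I x] by metis
  then show ?thesis by (simp add: face_vectors_def)
qed

section \<open>Surjections between coordinate spaces\<close>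

lemma sum_fun_apply: "(\<Sum>x\<in>A. f x) y = (\<Sum>x\<in>A. f x y)"
  by (induction A rule: infinite_finite_induct) (simp_all add: zero_fun_def plus_fun_def)

text \<open>Rank and nullity for coordinate subspaces of one function space: a linear right inverse of \<open>T\<close> embeds
  the target in the source, and by dimension it fills the source. The sets \<open>P\<close> and \<open>Q\<close> index the
  coordinates of source and target.\<close>

lemma surjective_imp_trivial_kernel:
  fixes T :: "('i::finite \<Rightarrow> 'k::field) \<Rightarrow> 'i \<Rightarrow> 'k" and P Q :: "'i set"
  assumes lin: "\<And>c u d v. T (\<lambda>x. c * u x + d * v x) = (\<lambda>x. c * T u x + d * T v x)"
    and card: "card P \<le> card Q"
    and surj: "\<And>w. (\<forall>x. x \<notin> Q \<longrightarrow> w x = 0) \<Longrightarrow> \<exists>u. (\<forall>x. x \<notin> P \<longrightarrow> u x = 0) \<and> T u = w"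
    and u: "\<And>x. x \<notin> P \<Longrightarrow> u x = 0" "T u = (\<lambda>_. 0)"
  shows "u = (\<lambda>_. 0)"
proof -
  define s where "s = (\<lambda>(c::'k) (u::'i \<Rightarrow> 'k) x. c * u x)"
  define e where "e = (\<lambda>(i::'i) x. if x = i then 1 else (0::'k))"
  define S where "S R = {u :: 'i \<Rightarrow> 'k. \<forall>x. x \<notin> R \<longrightarrow> u x = 0}" for R
  interpret V: vector_space s
    by unfold_locales (auto simp: s_def fun_eq_iff algebra_simps)
  have inj_e: "inj e"
    by (rule injI) (metis e_def zero_neq_one)
  have sum_e: "(\<Sum>i\<in>R. s (w i) (e i)) x = (if x \<in> R then w x else 0)" for R w x
    by (simp add: sum_fun_apply s_def e_def if_distrib cong: if_cong)
  have indep: "V.independent (e ` R)" for R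
  proof (rule V.independent_if_scalars_zero)
    fix f v assume f: "(\<Sum>v\<in>e ` R. s (f v) v) = 0" "v \<in> e ` R"
    then obtain i where i: "i \<in> R" "v = e i" by blast
    have "(\<Sum>v\<in>e ` R. s (f v) v) = (\<Sum>i\<in>R. s (f (e i)) (e i))"
      by (rule sum.reindex_cong[OF inj_on_subset[OF inj_e]]) auto
    then have "0 = (\<Sum>i\<in>R. s (f (e i)) (e i)) i" using f(1) by (metis zero_fun_apply)
    then show "f v = 0" using sum_e[of "\<lambda>i. f (e i)" R i] i by simp
  qed simp
  have S_sub: "V.subspace (S R)" for R
    by (rule V.subspaceI) (auto simp: S_def s_def)
  have e_S: "e ` R \<subseteq> S R" for R by (auto simp: S_def e_def)
  have S_span: "S R \<subseteq> V.span (e ` R)" for R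
  proof
    fix w assume "w \<in> S R"
    then have "w = (\<Sum>i\<in>R. s (w i) (e i))"
      by (intro ext) (simp add: sum_e S_def)
    also have "\<dots> \<in> V.span (e ` R)"
      by (intro V.span_sum V.span_scale V.span_base) auto
    finally show "w \<in> V.span (e ` R)" .
  qed
  interpret F: finite_dimensional_vector_space s "range e"
  proof
    show "V.span (range e) = UNIV" using S_span[of UNIV] by (auto simp: S_def)
  qed (simp_all add: indep)
  have dim: "V.dim (S R) = card R" for R
    by (rule V.dim_unique[OF e_S S_span indep]) (simp add: card_image inj_on_subset[OF inj_e])
  interpret VP: vector_space_pair s s ..
  interpret FP: finite_dimensional_vector_space_pair_1 s "range e" s ..
  have "Vector_Spaces.linear s s T"
  proof -
    have "T (v + w) = T v + T w" for v w
      using lin[of 1 v 1 w] by (simp add: plus_fun_def)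
    moreover have "T (s r v) = s r (T v)" for r v
      using lin[of r v 0 v] by (simp add: s_def)
    ultimately show ?thesis
      using V.vector_space_axioms by (simp add: Vector_Spaces.linear_iff)
  qed
  from VP.linear_exists_right_inverse_on[OF this S_sub[of P]]
  obtain g where g: "range g \<subseteq> S P" "Vector_Spaces.linear s s g" "\<forall>w\<in>T ` S P. T (g w) = w"
    by blast
  have SQ: "S Q \<subseteq> T ` S P"
  proof
    fix w assume "w \<in> S Q"
    then obtain v where "\<forall>x. x \<notin> P \<longrightarrow> v x = 0" "T v = w"
      using surj[of w] by (auto simp: S_def)
    then show "w \<in> T ` S P" by (auto simp: S_def)
  qed
  have "inj_on g (S Q)"
    using g(3) SQ by (intro inj_onI) (metis subsetD)
  then have "V.dim (g ` S Q) = V.dim (S Q)"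
    using S_sub[of Q] by (intro FP.dim_image_eq g(2)) (metis V.span_eq_iff)
  then have "g ` S Q = S P"
    using g card dim by (intro F.subspace_dim_equal VP.linear_subspace_image S_sub) auto
  moreover have "u \<in> S P" using u(1) by (auto simp: S_def)
  ultimately obtain w where w: "w \<in> S Q" "u = g w" by blast
  then have "w = 0" using g(3) SQ u(2) by (auto simp: zero_fun_def)
  then have "u = 0" using w(2) VP.linear_0[OF g(2)] by simp
  then show ?thesis by (simp add: zero_fun_def)
qed

section \<open>Pencils and faces when all lines have the same size\<close>

context
  fixes L :: "'p::finite set set" and m :: nat
  assumes ls: "linear_space L" and two: "2 \<le> card L"
    and lines: "\<And>l. l \<in> L \<Longrightarrow> card l = m"
    and m3: "3 \<le> m"
begin

lemma card_pencil: "card {l\<in>L. p \<in> l} * (m - 1) = card (UNIV :: 'p set) - 1"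
proof -
  have "card (UNIV - {p}) = (\<Sum>l\<in>{l\<in>L. p \<in> l}. card (l - {p}))"
    unfolding pencil_partition(1)[OF ls, of p, symmetric]
    by (rule card_UN_disjoint[OF _ _ pencil_partition(2)[OF ls]]) simp_all
  also have "\<dots> = (\<Sum>l\<in>{l\<in>L. p \<in> l}. m - 1)"
    using lines by (intro sum.cong) auto
  finally have "card (UNIV - {p}) = card {l\<in>L. p \<in> l} * (m - 1)"
    by (simp only: sum_constant of_nat_id)
  moreover have "card (UNIV - {p}) = card (UNIV :: 'p set) - 1"
    by (rule card_Diff_singleton) simp
  ultimately show ?thesis by (simp only:)
qed

lemma card_pencil_eq: "card {l\<in>L. p \<in> l} = card {l\<in>L. q \<in> l}"
proof -
  have "card {l\<in>L. p \<in> l} * (m - 1) = card {l\<in>L. q \<in> l} * (m - 1)"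
    by (simp only: card_pencil)
  then show ?thesis using m3 by simp
qed

lemma ex_point_off_line: obtains l p where "l \<in> L" "p \<notin> l"
proof -
  obtain l l' where l: "l \<in> L" "l' \<in> L" "l \<noteq> l'"
  proof -
    have "\<not> (\<forall>l\<in>L. \<forall>l'\<in>L. l = l')"
      using two card_le_Suc0_iff_eq[OF finite[of L]] by linarith
    then show ?thesis using that by blast
  qed
  have "\<not> l \<subseteq> l'"
    using linear_space_line_unique[OF ls l(1,2), of l] lines[OF l(1)] m3 l(3) by auto
  then show ?thesis using that l(2) by blast
qed

text \<open>Every point \<open>q\<close> off a line \<open>l\<close> is joined to the points of \<open>l\<close> by distinct lines; and all pencils have the
  same size.\<close>

lemma line_size_le_pencil: "m \<le> card {l\<in>L. p \<in> l}"
proof -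
  obtain l q where lq: "l \<in> L" "q \<notin> l" by (rule ex_point_off_line)
  have "\<forall>x\<in>l. \<exists>k. k \<in> L \<and> q \<in> k \<and> x \<in> k"
    using linear_space_ex1_line[OF ls, of q] lq(2) by metis
  then obtain f where f: "\<And>x. x \<in> l \<Longrightarrow> f x \<in> L \<and> q \<in> f x \<and> x \<in> f x" by metis
  have "inj_on f l"
  proof (rule inj_onI, rule ccontr)
    fix x y assume xy: "x \<in> l" "y \<in> l" "f x = f y" "x \<noteq> y"
    then have "f x = l"
      using linear_space_ex1_line[OF ls xy(4)] f[OF xy(1)] f[OF xy(2)] lq(1) by auto
    then show False using f[OF xy(1)] lq(2) by auto
  qed
  then have "card l \<le> card {k\<in>L. q \<in> k}"
    by (rule card_inj_on_le) (use f in auto)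
  then have "m \<le> card {k\<in>L. q \<in> k}" using lines[OF lq(1)] by simp
  moreover have "card {k\<in>L. q \<in> k} = card {l\<in>L. p \<in> l}"
    by (rule card_pencil_eq)
  ultimately show ?thesis by simp
qed

text \<open>In a plane the lines through a point off \<open>l\<close> meet \<open>l\<close> in distinct points, which is the reverse inequality.\<close>

lemma pencil_eq_line_size:
  assumes "finite_projective_plane L"
  shows "card {l\<in>L. p \<in> l} = m"
proof -
  obtain l q where lq: "l \<in> L" "q \<notin> l" by (rule ex_point_off_line)
  have meet: "\<exists>!x. x \<in> l \<and> x \<in> k" if "k \<in> L" "l \<noteq> k" for k
    using assms lq(1) that by (simp add: finite_projective_plane_def)
  have "\<forall>k\<in>{k\<in>L. q \<in> k}. \<exists>x. x \<in> l \<and> x \<in> k"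
  proof
    fix k assume "k \<in> {k\<in>L. q \<in> k}"
    then show "\<exists>x. x \<in> l \<and> x \<in> k" using meet[of k] lq(2) by auto
  qed
  then obtain f where f: "\<And>k. k \<in> L \<Longrightarrow> q \<in> k \<Longrightarrow> f k \<in> l \<and> f k \<in> k" by (metis mem_Collect_eq)
  have "inj_on f {k\<in>L. q \<in> k}"
  proof (rule inj_onI)
    fix k k' assume k: "k \<in> {k\<in>L. q \<in> k}" "k' \<in> {k\<in>L. q \<in> k}" "f k = f k'"
    then have fk: "k \<in> L" "k' \<in> L" "q \<in> k" "q \<in> k'" "f k \<in> l" "f k \<in> k" "f k \<in> k'"
      using f[of k] f[of k'] by auto
    then have "f k \<noteq> q" using lq(2) by auto
    then show "k = k'" using linear_space_ex1_line[OF ls, of "f k" q] fk by auto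
  qed
  then have "card {k\<in>L. q \<in> k} \<le> card l"
    by (rule card_inj_on_le) (use f in auto)
  then have "card {k\<in>L. q \<in> k} \<le> m" using lines[OF lq(1)] by simp
  moreover have "card {k\<in>L. q \<in> k} = card {l\<in>L. p \<in> l}"
    by (rule card_pencil_eq)
  ultimately show ?thesis using line_size_le_pencil[of p] by simp
qed

lemma card_face_le: "F \<in> incidence_complex L \<Longrightarrow> card F \<le> m"
  using lines by (auto simp: incidence_complex_def intro: card_mono[OF finite])

text \<open>Double counting of pairs of a face of size \<open>j\<close> in a face of size \<open>j + 1\<close>. The smaller face lies in some
  line and so has at least \<open>m - j \<ge> j + 1\<close> extensions; the larger one has \<open>j + 1\<close> subsets of
  size \<open>j\<close>.\<close>

lemma face_numbers_increasing:
  assumes "2 * j + 1 \<le> m"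
  shows "card {F \<in> incidence_complex L. card F = j} \<le> card {F \<in> incidence_complex L. card F = j + 1}"
proof -
  let ?A = "{F \<in> incidence_complex L. card F = j}" and ?B = "{F \<in> incidence_complex L. card F = j + 1}"
  have sup: "j + 1 \<le> card {G\<in>?B. F \<subseteq> G}" if F: "F \<in> ?A" for F
  proof -
    obtain l where l: "l \<in> L" "F \<subseteq> l" using F by (auto simp: incidence_complex_def)
    have "inj_on (\<lambda>x. insert x F) (l - F)" by (rule inj_onI) blast
    moreover have "(\<lambda>x. insert x F) ` (l - F) \<subseteq> {G\<in>?B. F \<subseteq> G}"
      using l F by (auto simp: incidence_complex_def)
    ultimately have "card (l - F) \<le> card {G\<in>?B. F \<subseteq> G}" by (rule card_inj_on_le) simp
    moreover have "card (l - F) = m - j" using l F lines by (simp add: card_Diff_subset)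
    ultimately show ?thesis using assms by simp
  qed
  have sub: "card {F\<in>?A. F \<subseteq> G} = j + 1" if G: "G \<in> ?B" for G
  proof -
    have "{F\<in>?A. F \<subseteq> G} = {F. F \<subseteq> G \<and> card F = j}" using G subset_face[of G L] by auto
    then show ?thesis using G n_subsets[of G j] by simp
  qed
  have "(j + 1) * card ?A \<le> (\<Sum>F\<in>?A. card {G\<in>?B. F \<subseteq> G})"
    using sum_mono[of ?A "\<lambda>_. j + 1", OF sup] by (simp add: mult.commute)
  also have "\<dots> = (\<Sum>F\<in>?A. \<Sum>G\<in>{G\<in>?B. F \<subseteq> G}. 1)" by simp
  also have "\<dots> = (\<Sum>G\<in>?B. \<Sum>F\<in>{F\<in>?A. F \<subseteq> G}. 1)" by (rule sum.swap_restrict) auto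
  also have "\<dots> = (\<Sum>G\<in>?B. j + 1)" using sub by (intro sum.cong) auto
  also have "\<dots> = (j + 1) * card ?B" by simp
  finally show ?thesis unfolding Suc_eq_plus1[symmetric] by (simp only: Suc_mult_le_cancel1)
qed

section \<open>Maximal rank when all lines have the same size\<close>

text \<open>A vector in the kernel restricts to the kernel on each line, and every face lies on a line.\<close>

lemma face_mult_injective:
  fixes a :: "'p \<Rightarrow> 'k::field"
  assumes "\<And>p. a p \<noteq> 0" "2 * i + j \<le> m"
    and "\<And>n. 0 < n \<Longrightarrow> n \<le> i + j \<Longrightarrow> of_nat n \<noteq> (0 :: 'k)"
  shows "inj_on (face_mult L a j) (face_vectors L i)"
proof (rule inj_on_face_multI)
  fix u assume u: "u \<in> face_vectors L i" "face_mult L a j u = (\<lambda>_. 0)"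
  have "u F = 0" if "l \<in> L" "F \<subseteq> l" for F l
  proof (rule lin_mult_pow_injective[of l a i j u F])
    fix G assume "G \<subseteq> l"
    then have "G \<in> incidence_complex L" using that by (auto simp: incidence_complex_def)
    then show "(lin_mult a ^^ j) u G = 0" using fun_cong[OF u(2), of G] by (simp add: face_mult_def)
  qed (use assms that lines u(1) in \<open>auto simp: face_vectors_def\<close>)
  then show "u = (\<lambda>_. 0)"
    using u(1) by (intro ext) (auto simp: face_vectors_def incidence_complex_def)
qed

text \<open>Preimages found line by line glue to a single vector: a face of size \<open>i \<ge> 2\<close> lies on exactly one line.
  This is where degree one differs.\<close>

lemma face_mult_surjective:
  fixes a :: "'p \<Rightarrow> 'k::field"
  assumes "\<And>p. a p \<noteq> 0" "2 \<le> i" "m \<le> 2 * i + j"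
    and "\<And>n. 0 < n \<Longrightarrow> n \<le> m - i \<Longrightarrow> of_nat n \<noteq> (0 :: 'k)"
  shows "face_mult L a j ` face_vectors L i = face_vectors L (i + j)"
proof
  show "face_mult L a j ` face_vectors L i \<subseteq> face_vectors L (i + j)"
    using face_mult_in by blast
  show "face_vectors L (i + j) \<subseteq> face_mult L a j ` face_vectors L i"
  proof
    fix v :: "'p set \<Rightarrow> 'k" assume v: "v \<in> face_vectors L (i + j)"
    have "\<forall>l\<in>L. \<exists>w. concentrated i w \<and> (\<forall>F\<subseteq>l. (lin_mult a ^^ j) w F = v F)"
    proof
      fix l assume "l \<in> L"
      then show "\<exists>w. concentrated i w \<and> (\<forall>F\<subseteq>l. (lin_mult a ^^ j) w F = v F)"
        using v assms lines
        by (intro lin_mult_pow_surjective) (auto simp: face_vectors_def concentrated_def)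
    qed
    then obtain w where w: "\<And>l. l \<in> L \<Longrightarrow> concentrated i (w l)"
        "\<And>l F. l \<in> L \<Longrightarrow> F \<subseteq> l \<Longrightarrow> (lin_mult a ^^ j) (w l) F = v F"
      by metis
    \<comment> \<open>The chosen line is the only one through \<open>F\<close> because \<open>card F = i \<ge> 2\<close>.\<close>
    define u where "u F = (if F \<in> incidence_complex L \<and> card F = i
      then w (SOME l. l \<in> L \<and> F \<subseteq> l) F else 0)" for F
    have u_w: "u G = w l G" if "l \<in> L" "G \<subseteq> l" for l G
    proof (cases "card G = i")
      case True
      have ex: "\<exists>l. l \<in> L \<and> G \<subseteq> l" using that by blast
      have "(SOME l. l \<in> L \<and> G \<subseteq> l) = l"
        using linear_space_line_unique[OF ls _ that(1) _ that(2)] someI_ex[OF ex] True assms(2) by auto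
      then show ?thesis using True that by (auto simp: u_def incidence_complex_def)
    next
      case False
      then show ?thesis using w(1)[OF that(1)] by (simp add: u_def concentrated_def)
    qed
    have "u \<in> face_vectors L i" by (auto simp: u_def face_vectors_def split: if_splits)
    moreover have "face_mult L a j u = v"
    proof
      fix F
      show "face_mult L a j u F = v F"
      proof (cases "F \<in> incidence_complex L")
        case True
        then obtain l where l: "l \<in> L" "F \<subseteq> l" by (auto simp: incidence_complex_def)
        have "(lin_mult a ^^ j) u F = (lin_mult a ^^ j) (w l) F"
          using l by (intro lin_mult_pow_cong u_w) auto
        then show ?thesis using w(2)[OF l] True by (simp add: face_mult_def)
      next
        case False
        then show ?thesis using v by (auto simp: face_mult_def face_vectors_def)
      qed
    qed
    ultimately show "v \<in> face_mult L a j ` face_vectors L i" by blast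
  qed
qed

lemma face_vectors_above: "m < i \<Longrightarrow> face_vectors L i = {\<lambda>_. 0}"
  using card_face_le by (fastforce simp: face_vectors_def)

lemma face_mult_surjective_above:
  assumes "m < i + j"
  shows "face_mult L a j ` face_vectors L i = face_vectors L (i + j)"
proof -
  have "face_mult L a j u = (\<lambda>_. 0)" if "u \<in> face_vectors L i" for u
    using face_mult_in[OF that, of a j] unfolding face_vectors_above[OF assms] by simp
  moreover have "face_mult L a j (\<lambda>_. 0) \<in> face_mult L a j ` face_vectors L i"
    by (intro imageI zero_in_face_vectors)
  ultimately have "face_mult L a j ` face_vectors L i = {\<lambda>_. 0}"
    by auto
  then show ?thesis by (simp only: face_vectors_above[OF assms])
qed

text \<open>The one map that cannot be checked line by line: it sends points to lines. With \<open>c\<^sub>p = u\<^sub>p / a\<^sub>p\<close>, a kernel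
  element has sum zero over each line. Summing over the \<open>r\<close> lines through \<open>p\<close> gives
  \<open>(r - 1) c\<^sub>p + \<Sum> c = 0\<close>, so \<open>c\<close> is constant, and then \<open>m c = 0\<close> on a line.\<close>

lemma face_mult_points_to_lines_injective:
  fixes a :: "'p \<Rightarrow> 'k::field" and q :: 'p
  assumes a: "\<And>p. a p \<noteq> 0"
    and char: "\<And>n. 0 < n \<Longrightarrow> n \<le> card {l\<in>L. q \<in> l} \<Longrightarrow> of_nat n \<noteq> (0 :: 'k)"
  shows "inj_on (face_mult L a (m - 1)) (face_vectors L 1)"
proof (rule inj_on_face_multI)
  fix u :: "'p set \<Rightarrow> 'k" assume u: "u \<in> face_vectors L 1" "face_mult L a (m - 1) u = (\<lambda>_. 0)"
  define c where "c p = u {p} / a p" for p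
  define r where "r = card {l\<in>L. q \<in> l}"
  have r: "card {l\<in>L. p \<in> l} = r" for p
    unfolding r_def by (rule card_pencil_eq)
  have mr: "m \<le> r" unfolding r_def by (rule line_size_le_pencil)
  have fact: "of_nat (fact (m - 1)) \<noteq> (0 :: 'k)"
  proof -
    have "of_nat (fact n) \<noteq> (0 :: 'k)" if "n \<le> r" for n
      using that
    proof (induction n)
      case (Suc n)
      then show ?case using char[of "Suc n"]
        unfolding fact_Suc of_nat_id of_nat_mult by (simp add: r_def del: of_nat_Suc)
    qed simp
    then show ?thesis using mr by simp
  qed
  have line: "sum c l = 0" if "l \<in> L" for l
  proof -
    have "l \<in> incidence_complex L" using that by (auto simp: incidence_complex_def)
    then have "(lin_mult a ^^ (m - 1)) u l = 0" using fun_cong[OF u(2), of l] by (simp add: face_mult_def)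
    moreover have "card l = Suc (m - 1)" using lines[OF that] m3 by simp
    ultimately have "of_nat (fact (m - 1)) * sum c l * prod a l = 0"
      using lin_mult_pow_degree_one[of a l "m - 1" u] a by (simp add: c_def)
    then show ?thesis using fact a by simp
  qed
  have eq: "of_nat (r - 1) * c p = - sum c UNIV" for p
  proof -
    have "c p = of_nat r * c p + sum c UNIV"
      using pencil_sum[OF ls, where c = c and p = p] line by (simp add: r)
    moreover have "(of_nat r :: 'k) = of_nat (r - 1) + 1"
      using mr m3 by (metis Suc_eq_plus1 Suc_diff_1 le_trans of_nat_Suc add.commute
        zero_less_numeral less_le_trans)
    ultimately show ?thesis by (simp add: algebra_simps eq_neg_iff_add_eq_0)
  qed
  have "of_nat (r - 1) \<noteq> (0 :: 'k)" using char[of "r - 1"] mr m3 by (simp add: r_def)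
  then have const: "c p = c q" for p using eq[of p] eq[of q] by (metis mult_left_cancel)
  obtain l where l: "l \<in> L" using two by fastforce
  have "sum c l = of_nat m * c q" using const lines[OF l] by (simp add: sum.cong[OF refl const])
  moreover have "of_nat m \<noteq> (0 :: 'k)" using char[of m] mr m3 by (simp add: r_def)
  ultimately have "c q = 0" using line[OF l] by simp
  have "u {p} = 0" for p
  proof -
    have "c p = 0" using const[of p] \<open>c q = 0\<close> by simp
    then show ?thesis using a[of p] by (simp add: c_def)
  qed
  then have "u F = 0" if "card F = 1" for F using that by (auto simp: card_1_singleton_iff)
  then show "u = (\<lambda>_. 0)"
    using u(1) by (intro ext) (auto simp: face_vectors_def)
qed

text \<open>Some power \<open>\<ell>\<^bsup>j\<^esup> \<noteq> 0\<close> with \<open>j < char\<close> is killed by \<open>\<ell>\<close>, because \<open>\<ell>\<^bsup>char\<^esup> = 0\<close>. So \<open>\<ell>\<close> is not injective in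
  degree \<open>j\<close>. It is not surjective either, since in this range the dimension does not drop from degree \<open>j\<close> to
  \<open>j + 1\<close>. The argument covers every linear form, not only general ones.\<close>

lemma not_maximal_rank_if_small_CHAR:
  fixes a :: "'p \<Rightarrow> 'k::field"
  assumes "0 < CHAR('k)" "2 * CHAR('k) \<le> m + 1"
  obtains j where "\<not> maximal_rank (face_mult L a 1) (face_vectors L j) (face_vectors L (j + 1))"
proof -
  define w where "w j = face_mult L a j (\<lambda>F. of_bool (F = {}))" for j
  obtain l where l: "l \<in> L" using two by fastforce
  then have "{} \<in> incidence_complex L" by (auto simp: incidence_complex_def)
  then have one: "(\<lambda>F. of_bool (F = {})) \<in> face_vectors L 0" by (simp add: face_vectors_def)
  have "w 0 \<noteq> (\<lambda>_. 0)"
    using \<open>{} \<in> _\<close> by (auto simp: w_def face_mult_def fun_eq_iff intro!: exI[of _ "{}"])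
  moreover have "w CHAR('k) = (\<lambda>_. 0)"
    unfolding w_def by (rule face_mult_pow_CHAR_eq_0[OF assms(1) one])
  ultimately obtain j where j: "j < CHAR('k)" "w j \<noteq> (\<lambda>_. 0)" "w (Suc j) = (\<lambda>_. 0)"
    using ex_least_nat_less[of "\<lambda>j. w j = (\<lambda>_. 0)"] by blast
  have wj: "w j \<in> face_vectors L j" using face_mult_in[OF one, of a j] by (simp add: w_def)
  have ker: "face_mult L a 1 (w j) = (\<lambda>_. 0)"
    using j(3) unfolding w_def by (simp only: face_mult_1_face_mult)
  have "\<not> inj_on (face_mult L a 1) (face_vectors L j)"
  proof
    assume "inj_on (face_mult L a 1) (face_vectors L j)"
    then have "w j = (\<lambda>_. 0)"
      by (rule inj_onD) (use ker wj in \<open>simp_all add: face_mult_zero zero_in_face_vectors\<close>)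
    then show False using j(2) by contradiction
  qed
  moreover have "face_mult L a 1 ` face_vectors L j \<noteq> face_vectors L (j + 1)"
  proof
    assume img: "face_mult L a 1 ` face_vectors L j = face_vectors L (j + 1)"
    have supp: "u \<in> face_vectors L i \<longleftrightarrow> (\<forall>F. F \<notin> {F \<in> incidence_complex L. card F = i} \<longrightarrow> u F = 0)"
      for u :: "'p set \<Rightarrow> 'k" and i
      by (auto simp: face_vectors_def)
    have "w j = (\<lambda>_. 0)"
    proof (rule surjective_imp_trivial_kernel[of "face_mult L a 1"
          "{F \<in> incidence_complex L. card F = j}" "{F \<in> incidence_complex L. card F = j + 1}" "w j"])
      show "face_mult L a 1 (\<lambda>F. c * u F + d * v F)
          = (\<lambda>F. c * face_mult L a 1 u F + d * face_mult L a 1 v F)" for c d u v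
        unfolding face_mult_def lin_mult_pow_linear by (simp add: fun_eq_iff)
      show "card {F \<in> incidence_complex L. card F = j} \<le> card {F \<in> incidence_complex L. card F = j + 1}"
        using face_numbers_increasing[of j] j(1) assms(2) by simp
      fix v :: "'p set \<Rightarrow> 'k" assume "\<forall>F. F \<notin> {F \<in> incidence_complex L. card F = j + 1} \<longrightarrow> v F = 0"
      then have "v \<in> face_mult L a 1 ` face_vectors L j" unfolding img supp .
      then show "\<exists>u. (\<forall>F. F \<notin> {F \<in> incidence_complex L. card F = j} \<longrightarrow> u F = 0) \<and> face_mult L a 1 u = v"
        unfolding supp[symmetric] by blast
    next
      fix F assume "F \<notin> {F \<in> incidence_complex L. card F = j}"
      then show "w j F = 0" using wj unfolding supp by blast
    qed (rule ker)
    then show False using j(2) by contradiction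
  qed
  ultimately show ?thesis using that[of j] by (simp add: maximal_rank_def)
qed

section \<open>Socle and Lefschetz properties\<close>

context
  fixes I :: "('p, 'k::field) mpoly set"
  assumes I: "I = inv_sys_ideal L"
begin

lemma singleton_in_complex: "{p} \<in> incidence_complex L"
  using singleton_face[OF ls] two by fastforce

text \<open>A face smaller than its line can be extended within it, so its coefficient is detected by a variable;
  a face of size \<open>m\<close> cannot be extended.\<close>

lemma level_if_uniform: "level_of_socle_degree I m"
proof -
  obtain l where l: "l \<in> L" using two by fastforce
  have zero: "\<zero>\<^bsub>quot_alg I\<^esub> = vec_class L (\<lambda>_. 0)"
    unfolding quot_zero[OF I] coset_eq_vec_class[OF I] by (simp add: sqfree_coeff_linear)
  have zero_in: "(\<lambda>_. 0) \<in> face_vectors L i" for i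
    by (simp add: face_vectors_def)
  have "vec_class L (\<lambda>F. of_bool (F = l)) \<in> graded_piece I m"
    unfolding graded_piece_eq[OF I]
    using l lines by (intro imageI) (auto simp: face_vectors_def incidence_complex_def)
  moreover have "vec_class L (\<lambda>F. of_bool (F = l)) \<noteq> \<zero>\<^bsub>quot_alg I\<^esub>"
  proof -
    have "(\<lambda>F. of_bool (F = l)) \<in> face_vectors L m"
      using l lines by (auto simp: face_vectors_def incidence_complex_def)
    then show ?thesis
      unfolding zero by (subst vec_class_eq_iff[OF I _ zero_in]) (auto simp: fun_eq_iff)
  qed
  ultimately have 1: "graded_piece I m \<noteq> {\<zero>\<^bsub>quot_alg I\<^esub>}" by blast
  have 2: "graded_piece I i = {\<zero>\<^bsub>quot_alg I\<^esub>}" if "m < i" for i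
  proof -
    have "face_vectors L i = {\<lambda>_. 0 :: 'k}" by (rule face_vectors_above[OF that])
    then show ?thesis unfolding graded_piece_eq[OF I] zero by simp
  qed
  have 3: "socle I = graded_piece I m"
  proof
    show "socle I \<subseteq> graded_piece I m"
    proof
      fix \<alpha> assume "\<alpha> \<in> socle I"
      then obtain f where f: "\<alpha> = I +>\<^bsub>poly_ring\<^esub> f"
        "\<And>F p. p \<notin> F \<Longrightarrow> insert p F \<in> incidence_complex L \<Longrightarrow> sqfree_coeff f F = 0"
        unfolding socle_eq[OF I] by blast
      define u where "u F = (if F \<in> incidence_complex L then sqfree_coeff f F else 0)" for F
      have "card F = m" if "u F \<noteq> 0" for F
      proof (rule ccontr)
        assume "card F \<noteq> m"
        obtain l where l: "l \<in> L" "F \<subseteq> l" "sqfree_coeff f F \<noteq> 0"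
          using \<open>u F \<noteq> 0\<close> by (auto simp: u_def incidence_complex_def split: if_splits)
        moreover have "F \<noteq> l" using lines[OF l(1)] \<open>card F \<noteq> m\<close> by auto
        ultimately obtain p where "p \<in> l" "p \<notin> F" by blast
        moreover have "insert p F \<in> incidence_complex L"
          using l \<open>p \<in> l\<close> by (auto simp: incidence_complex_def)
        ultimately show False using f(2) l(3) by blast
      qed
      then have "u \<in> face_vectors L m"
        by (auto simp: face_vectors_def u_def)
      moreover have "\<alpha> = vec_class L u"
        unfolding f(1) coset_eq_vec_class[OF I] by (simp add: u_def)
      ultimately show "\<alpha> \<in> graded_piece I m" unfolding graded_piece_eq[OF I] by blast
    qed
    show "graded_piece I m \<subseteq> socle I"
    proof
      fix \<alpha> assume "\<alpha> \<in> graded_piece I m"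
      then obtain u where u: "u \<in> face_vectors L m" "\<alpha> = vec_class L u"
        unfolding graded_piece_eq[OF I] by blast
      have "u F = 0" if "p \<notin> F" "insert p F \<in> incidence_complex L" for F p
      proof -
        have "card F < m" using card_face_le[OF that(2)] that(1) by simp
        then show ?thesis using u(1) by (auto simp: face_vectors_def)
      qed
      then show "\<alpha> \<in> socle I"
        unfolding socle_eq[OF I] u(2) vec_class_def I[symmetric]
        by (auto intro!: exI[of _ "vec_poly u"])
    qed
  qed
  show ?thesis unfolding level_of_socle_degree_def using 1 2 3 by blast
qed

lemma WLP_iff: "WLP I \<longleftrightarrow> CHAR('k) = 0 \<or> m + 2 \<le> 2 * CHAR('k)"
proof
  assume "WLP I"
  then obtain a :: "'p \<Rightarrow> 'k" where
    a: "\<And>i. maximal_rank (face_mult L a 1) (face_vectors L i) (face_vectors L (i + 1))"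
    by (rule WLP_E[OF I]) blast
  show "CHAR('k) = 0 \<or> m + 2 \<le> 2 * CHAR('k)"
  proof (rule ccontr)
    assume "\<not> ?thesis"
    then obtain j where "\<not> maximal_rank (face_mult L a 1) (face_vectors L j) (face_vectors L (j + 1))"
      using not_maximal_rank_if_small_CHAR[of a] by force
    then show False using a by contradiction
  qed
next
  assume char: "CHAR('k) = 0 \<or> m + 2 \<le> 2 * CHAR('k)"
  have unit: "of_nat n \<noteq> (0 :: 'k)" if "0 < n" "2 * n \<le> m + 1" for n
    using char that by (intro of_nat_neq_0_below_CHAR) auto
  show "WLP I"
  proof (rule WLP_I[OF I singleton_in_complex])
    fix a :: "'p \<Rightarrow> 'k" and i assume a: "\<And>p. a p \<noteq> 0"
    show "maximal_rank (face_mult L a 1) (face_vectors L i) (face_vectors L (i + 1))"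
    proof (cases "2 * i + 1 \<le> m")
      case True
      have "inj_on (face_mult L a 1) (face_vectors L i)"
      proof (rule face_mult_injective[OF a True])
        show "of_nat n \<noteq> (0 :: 'k)" if "0 < n" "n \<le> i + 1" for n
          using that True by (intro unit) auto
      qed
      then show ?thesis by (simp add: maximal_rank_def)
    next
      case False
      have "face_mult L a 1 ` face_vectors L i = face_vectors L (i + 1)"
      proof (rule face_mult_surjective[OF a])
        show "2 \<le> i" "m \<le> 2 * i + 1" using False m3 by auto
        show "of_nat n \<noteq> (0 :: 'k)" if "0 < n" "n \<le> m - i" for n
          using that False by (intro unit) auto
      qed
      then show ?thesis by (simp add: maximal_rank_def)
    qed
  qed
qed

text \<open>The power \<open>\<ell>\<^bsup>char\<^esup>\<close> is zero, while \<open>A\<^sub>0\<close> and \<open>A\<^bsub>char\<^esub>\<close> are not.\<close>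

lemma not_SLP_if_small_CHAR:
  assumes "0 < CHAR('k)" "CHAR('k) \<le> m"
  shows "\<not> SLP I"
proof
  assume "SLP I"
  then obtain a :: "'p \<Rightarrow> 'k" where
    "\<And>i j. maximal_rank (face_mult L a j) (face_vectors L i) (face_vectors L (i + j))"
    by (rule SLP_E[OF I]) blast
  from this[of "CHAR('k)" 0]
  have mr: "inj_on (face_mult L a CHAR('k)) (face_vectors L 0)
      \<or> face_mult L a CHAR('k) ` face_vectors L 0 = face_vectors L CHAR('k)"
    by (simp add: maximal_rank_def)
  obtain l where l: "l \<in> L" using two by fastforce
  have ind: "(\<lambda>F. of_bool (F = G)) \<in> face_vectors L (card G)" "(\<lambda>F. of_bool (F = G)) \<noteq> (\<lambda>_. 0 :: 'k)"
    if "G \<subseteq> l" for G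
    using that l by (auto simp: face_vectors_def incidence_complex_def fun_eq_iff)
  have zero: "face_mult L a CHAR('k) u = (\<lambda>_. 0)" if "u \<in> face_vectors L 0" for u
    by (rule face_mult_pow_CHAR_eq_0[OF assms(1) that])
  have zero_in: "(\<lambda>_. 0 :: 'k) \<in> face_vectors L 0" by (simp add: face_vectors_def)
  have one_in: "(\<lambda>F. of_bool (F = {}) :: 'k) \<in> face_vectors L 0" using ind(1)[of "{}"] by simp
  from mr show False
  proof
    assume "inj_on (face_mult L a CHAR('k)) (face_vectors L 0)"
    then have "(\<lambda>F :: 'p set. of_bool (F = {})) = (\<lambda>_. 0 :: 'k)"
      by (rule inj_onD) (use zero zero_in one_in in simp_all)
    then show False using ind(2)[of "{}"] by simp
  next
    assume img: "face_mult L a CHAR('k) ` face_vectors L 0 = face_vectors L CHAR('k)"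
    obtain G where G: "G \<subseteq> l" "card G = CHAR('k)"
      using obtain_subset_with_card_n[of "CHAR('k)" l] lines[OF l] assms(2) by blast
    then have "(\<lambda>F. of_bool (F = G)) \<in> face_mult L a CHAR('k) ` face_vectors L 0"
      unfolding img using ind(1)[OF G(1)] by simp
    then show False using zero ind(2)[OF G(1)] by auto
  qed
qed

text \<open>For \<open>2 i + j \<le> m\<close> the map is injective, and for \<open>i \<ge> 2\<close> and \<open>2 i + j \<ge> m\<close> it is surjective, in both cases
  from the lines alone. Beyond degree \<open>m\<close> the target is zero, which leaves \<open>i = 1\<close> and \<open>j = m - 1\<close>. Only
  that map needs the size \<open>r\<close> of the pencils to be inverted.\<close>

lemma SLP_if_large_CHAR:
  assumes "CHAR('k) = 0 \<or> card {l\<in>L. q \<in> l} < CHAR('k)"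
  shows "SLP I"
proof (rule SLP_I[OF I singleton_in_complex])
  have unit: "of_nat n \<noteq> (0 :: 'k)" if "0 < n" "n \<le> card {l\<in>L. q \<in> l}" for n
    using assms that by (intro of_nat_neq_0_below_CHAR) auto
  have mr: "m \<le> card {l\<in>L. q \<in> l}" by (rule line_size_le_pencil)
  fix a :: "'p \<Rightarrow> 'k" and i j assume a: "\<And>p. a p \<noteq> 0"
  consider "m < i + j" | "i + j \<le> m" "2 * i + j \<le> m" | "i = 1" "j = m - 1"
    | "i + j \<le> m" "2 \<le> i" "m \<le> 2 * i + j"
    by linarith
  then show "maximal_rank (face_mult L a j) (face_vectors L i) (face_vectors L (i + j))"
  proof cases
    case 1
    then show ?thesis
      using face_mult_surjective_above[OF 1, of a] by (simp add: maximal_rank_def)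
  next
    case 2
    have "inj_on (face_mult L a j) (face_vectors L i)"
    proof (rule face_mult_injective[OF a 2(2)])
      show "of_nat n \<noteq> (0 :: 'k)" if "0 < n" "n \<le> i + j" for n
        using that 2(1) mr by (intro unit) auto
    qed
    then show ?thesis by (simp add: maximal_rank_def)
  next
    case 3
    have "inj_on (face_mult L a (m - 1)) (face_vectors L 1)"
      by (rule face_mult_points_to_lines_injective[OF a unit])
    then show ?thesis using 3 by (simp add: maximal_rank_def)
  next
    case 4
    have "face_mult L a j ` face_vectors L i = face_vectors L (i + j)"
    proof (rule face_mult_surjective[OF a 4(2,3)])
      show "of_nat n \<noteq> (0 :: 'k)" if "0 < n" "n \<le> m - i" for n
        using that mr by (intro unit) auto
    qed
    then show ?thesis by (simp add: maximal_rank_def)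
  qed
qed

end

end

theorem theorem4p8:
  fixes L :: "'p::finite set set"
    and m d :: nat
    and I :: "('p, 'k::field) mpoly set"
  assumes "infinite (UNIV :: 'k set)"
    and "linear_space L"
    and "card L \<ge> 2"
    and "m \<ge> 3"
    and "d = card (UNIV :: 'p set)"
    and "I = inv_sys_ideal L"
  shows "(level_of_socle_degree I m \<longleftrightarrow> (\<forall>l\<in>L. card l = m)) \<and>
    (level_of_socle_degree I m \<longrightarrow>
      (WLP I \<longleftrightarrow> CHAR('k) = 0 \<or> int CHAR('k) > \<lceil>real m / 2\<rceil>) \<and>
      (2 \<le> CHAR('k) \<and> CHAR('k) \<le> m \<longrightarrow> \<not> SLP I) \<and>
      (CHAR('k) = 0 \<or> real CHAR('k) > max (real m) ((real d - 1) / (real m - 1))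
         \<longrightarrow> SLP I) \<and>
      max (real m) ((real d - 1) / (real m - 1)) = (real d - 1) / (real m - 1) \<and>
      (finite_projective_plane L \<longrightarrow>
         (SLP I \<longleftrightarrow> CHAR('k) = 0 \<or> CHAR('k) > m)))"
proof -
  note ls = assms(2) and two = assms(3) and m3 = assms(4) and I = assms(6)
  have level: "level_of_socle_degree I m \<longleftrightarrow> (\<forall>l\<in>L. card l = m)"
    using level_if_uniform[OF ls two _ m3 I] uniform_if_level[OF ls I] by blast
  {
    assume uniform: "\<forall>l\<in>L. card l = m"
    then have lines: "\<And>l. l \<in> L \<Longrightarrow> card l = m" by blast
    fix q :: 'p
    define r where "r = card {l\<in>L. q \<in> l}"
    have mr: "m \<le> r" unfolding r_def by (rule line_size_le_pencil[OF ls two lines m3])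
    have "r * (m - 1) = d - 1" unfolding r_def assms(5) by (rule card_pencil[OF ls two lines m3])
    then have "real r * real (m - 1) = real (d - 1)" by (metis of_nat_mult)
    moreover have "1 \<le> d" unfolding assms(5) by (simp add: Suc_le_eq card_gt_0_iff)
    ultimately have "real r * (real m - 1) = real d - 1" using m3 by (simp add: of_nat_diff)
    then have r: "(real d - 1) / (real m - 1) = real r" using m3 by (simp add: field_simps)
    have "WLP I \<longleftrightarrow> CHAR('k) = 0 \<or> m + 2 \<le> 2 * CHAR('k)"
      by (rule WLP_iff[OF ls two lines m3 I])
    \<comment> \<open>An integer exceeds \<open>\<lceil>m/2\<rceil>\<close> if and only if it is at least \<open>m/2 + 1\<close>.\<close>
    moreover have "int CHAR('k) > \<lceil>real m / 2\<rceil> \<longleftrightarrow> m + 2 \<le> 2 * CHAR('k)"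
      unfolding ceiling_less_iff by auto
    ultimately have wlp: "WLP I \<longleftrightarrow> CHAR('k) = 0 \<or> int CHAR('k) > \<lceil>real m / 2\<rceil>"
      by simp
    have slp: "CHAR('k) = 0 \<or> r < CHAR('k) \<Longrightarrow> SLP I"
      unfolding r_def by (rule SLP_if_large_CHAR[OF ls two lines m3 I])
    have nslp: "0 < CHAR('k) \<Longrightarrow> CHAR('k) \<le> m \<Longrightarrow> \<not> SLP I"
      by (rule not_SLP_if_small_CHAR[OF ls two lines m3 I])
    have plane: "r = m" if "finite_projective_plane L"
      unfolding r_def by (rule pencil_eq_line_size[OF ls two lines m3 that])
    have "(WLP I \<longleftrightarrow> CHAR('k) = 0 \<or> int CHAR('k) > \<lceil>real m / 2\<rceil>) \<and>
      (2 \<le> CHAR('k) \<and> CHAR('k) \<le> m \<longrightarrow> \<not> SLP I) \<and>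
      (CHAR('k) = 0 \<or> real CHAR('k) > max (real m) ((real d - 1) / (real m - 1)) \<longrightarrow> SLP I) \<and>
      max (real m) ((real d - 1) / (real m - 1)) = (real d - 1) / (real m - 1) \<and>
      (finite_projective_plane L \<longrightarrow> (SLP I \<longleftrightarrow> CHAR('k) = 0 \<or> CHAR('k) > m))"
    proof (intro conjI impI)
      show "SLP I \<longleftrightarrow> CHAR('k) = 0 \<or> CHAR('k) > m" if "finite_projective_plane L"
        using slp nslp plane[OF that] by (meson not_gr_zero not_less)
    qed (use wlp slp nslp mr in \<open>auto simp: r\<close>)
  }
  then show ?thesis using level by blast
qed

end
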